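(* Let $C(x)=\exp\left(\sum_{n=1}^{\infty}\frac{1}{n}\Phi(-\sqrt{n}\,x)\right)$ for $x>0$, where $\Phi$ is the standard normal CDF. Consider the fixed-budget ranking-and-selection setting described in the context, and suppose there exist constants $\gamma>0$ and $\bar\sigma^2>0$ such that, for every $k$, $\mu_1-\max_{i=2,\ldots,k}\mu_i\ge\gamma$ and $\max_{i=1,\ldots,k}\sigma_i^2\le\bar\sigma^2$. If the total sampling budget is $B=ck$ with $c>C(\gamma/\bar\sigma)$, then the probability of correct selection of the greedy procedure satisfies $$\liminf_{k\to\infty}\mathrm{PCS}\ \ge\ \Pr\left\{\min_{n\ge1}\bar X_1(n)>\mu_1-\gamma_0\right\}=\left[C\left(\frac{\gamma_0}{\sigma_1}\right)\right]^{-1}>0,$$ where $\gamma_0\in(0,\gamma)$ is the constant satisfying $C\left(\frac{\gamma-\gamma_0}{\bar\sigma}\right)=c$.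
   Context: For each $k\ge2$ there are $k$ alternatives; alternative $i$ produces i.i.d. observations distributed $N(\mu_i,\sigma_i^2)$, and observations are independent across alternatives. Alternative 1 is the unique best: $\mu_1>\mu_i$ for all $i\ge2$. The best alternative's mean $\mu_1$ and variance $\sigma_1^2>0$ are the same for all $k$. $\bar X_i(n)$ denotes the sample mean of the first $n$ observations of alternative $i$. Greedy procedure with budget $B$: take one observation from each of the $k$ alternatives; then, while the total number of observations taken is less than $B$, take one more observation from the alternative whose current sample mean $\bar X_i(n_i)$ (with $n_i$ its current sample size) is largest; when the budget is exhausted, select the alternative with the largest sample mean. PCS is the probability that alternative 1 is selected. The limit is taken as $k\to\infty$ with $B=ck$. *)

theory Defs
  imports "HOL-Probability.Probability"
begin

definition Phi :: "real \<Rightarrow> real" where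
  "Phi x = cdf (density lborel std_normal_density) x"

definition Cfun :: "real \<Rightarrow> real" where
  "Cfun x = exp (\<Sum>n. Phi (- sqrt (real (Suc n)) * x) / real (Suc n))"

definition xbar :: "(nat \<times> nat \<Rightarrow> real) \<Rightarrow> nat \<Rightarrow> nat \<Rightarrow> real" where
  "xbar \<omega> i n = (\<Sum>m<n. \<omega> (i, m)) / real n"

text \<open>Index in {1..k} with the largest current sample mean (ties, a null event,
  broken by smallest index).\<close>
definition best_idx :: "nat \<Rightarrow> (nat \<times> nat \<Rightarrow> real) \<Rightarrow> (nat \<Rightarrow> nat) \<Rightarrow> nat" where
  "best_idx k \<omega> cnt = (LEAST i. i \<in> {1..k} \<and>
      (\<forall>j\<in>{1..k}. xbar \<omega> j (cnt j) \<le> xbar \<omega> i (cnt i)))"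

fun greedy_counts :: "nat \<Rightarrow> (nat \<times> nat \<Rightarrow> real) \<Rightarrow> nat \<Rightarrow> nat \<Rightarrow> nat" where
  "greedy_counts k \<omega> 0 = (\<lambda>i. 1)"
| "greedy_counts k \<omega> (Suc t) =
     (let cnt = greedy_counts k \<omega> t; b = best_idx k \<omega> cnt in cnt(b := cnt b + 1))"

text \<open>Alternative selected by the greedy procedure with k alternatives and budget B:
  after the k initial observations, B - k greedy observations are taken
  (the loop runs while the total number of observations is below B).\<close>
definition greedy_select :: "nat \<Rightarrow> nat \<Rightarrow> (nat \<times> nat \<Rightarrow> real) \<Rightarrow> nat" where
  "greedy_select k B \<omega> = best_idx k \<omega> (greedy_counts k \<omega> (B - k))"

text \<open>Joint law of all observations: \<omega>(i,n) is the (n+1)-th observation of alternative i;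
  all independent, alternative i in {1..k} is N(mu i, sg i ^ 2); unused indices are 0.\<close>
definition obs_measure :: "nat \<Rightarrow> (nat \<Rightarrow> real) \<Rightarrow> (nat \<Rightarrow> real) \<Rightarrow> (nat \<times> nat \<Rightarrow> real) measure" where
  "obs_measure k mu sg = PiM UNIV (\<lambda>(i, n). if i \<in> {1..k}
      then density lborel (normal_density (mu i) (sg i)) else return borel 0)"

definition PCS :: "nat \<Rightarrow> nat \<Rightarrow> (nat \<Rightarrow> real) \<Rightarrow> (nat \<Rightarrow> real) \<Rightarrow> real" where
  "PCS k B mu sg = measure (obs_measure k mu sg)
      {\<omega> \<in> space (obs_measure k mu sg). greedy_select k B \<omega> = 1}"

definition single_stream :: "real \<Rightarrow> real \<Rightarrow> (nat \<Rightarrow> real) measure" where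
  "single_stream m s = PiM UNIV (\<lambda>n. density lborel (normal_density m s))"

end

(*
  An inferior alternative is sampled only while its sample mean exceeds the running mean of
  alternative 1. If the latter attains its minimum after at most L observations and this minimum
  exceeds l = mu_1 - g, then alternative i consumes at most T_i observations, T_i being the first
  time its sample mean drops to l, and alternative 1 is selected as soon as L plus the sum of the
  T_i is below the budget. The means of the T_i are at most C((gamma - g)/sigmabar) < c for
  g < gamma0, so by Chebyshev's inequality the budget suffices with probability tending to 1.

  Both T_i and the event that the mean of alternative 1 stays above l concern the first descent
  of a random walk, and the function C enters through the Sparre Andersen identity
    1 - E[s^T] = exp(- sum_n s^n/n P(S_n <= 0)),
  where T is the first time the walk is nonpositive. It is obtained by counting the cyclic
  rotations of a path (rotation_unique) and letting s tend to 1.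
*)
theory Submission
  imports Defs
begin

section \<open>Ladder epochs and cyclic rotations\<close>

text \<open>The laws of the inferior alternatives may change with \<open>k\<close>, so no limit
  theorem for a fixed sequence applies: every moment bound has to be uniform and depends only on the
  smallest standardised distance \<open>(gamma - g) / sigmabar\<close>. The cutoff \<open>L\<close>
  is held fixed while \<open>k\<close> tends to infinity and is released afterwards; nothing is
  lost, because the minimum of the sample means of alternative 1 is almost surely attained. The
  identity serves walks of both drifts. For positive drift the terms P(S_n \<le> 0) / n are
  summable, and s = 1 gives the probability of never descending. For negative drift both sides tend
  to 0; dividing by 1 - s, itself the exponential of a logarithmic series, leaves the summable terms
  P(S_n > 0) / n and bounds the mean descent time. By symmetry of the normal law both series have
  the form that defines C, so one function is a reciprocal probability in the first case and a mean
  time in the second.\<close>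

definition psum :: "(nat \<Rightarrow> real) \<Rightarrow> nat \<Rightarrow> real" where
  "psum x n = (\<Sum>j<n. x j)"

definition first_descent :: "(nat \<Rightarrow> real) \<Rightarrow> nat \<Rightarrow> bool" where
  "first_descent x m \<longleftrightarrow> 0 < m \<and> psum x m \<le> 0 \<and> (\<forall>j\<in>{1..<m}. 0 < psum x j)"

text \<open>For \<open>n > 0\<close> these are the weak descending ladder epochs, not only the
  first; \<open>n = 0\<close> counts as the renewal at time zero.\<close>

definition weak_record :: "(nat \<Rightarrow> real) \<Rightarrow> nat \<Rightarrow> bool" where
  "weak_record x n \<longleftrightarrow> (\<forall>j<n. psum x n \<le> psum x j)"

text \<open>Indices from \<open>n\<close> on stay fixed, which makes \<open>rot n a\<close> a
  permutation of all indices; such a permutation preserves an i.i.d. law.\<close>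

definition rot :: "nat \<Rightarrow> nat \<Rightarrow> nat \<Rightarrow> nat" where
  "rot n a j = (if j < n then (j + a) mod n else j)"

lemma psum_0 [simp]: "psum x 0 = 0"
  by (simp add: psum_def)

lemma psum_cong: "(\<And>j. j < n \<Longrightarrow> x j = y j) \<Longrightarrow> psum x n = psum y n"
  unfolding psum_def by (rule sum.cong) auto

lemma psum_shift: "psum x (m + n) = psum x m + psum (\<lambda>j. x (m + j)) n"
  unfolding psum_def by (induction n) (auto simp: algebra_simps)

lemma first_descent_unique: "first_descent x m \<Longrightarrow> first_descent x m' \<Longrightarrow> m = m'"
  unfolding first_descent_def
  by (metis atLeastLessThan_iff less_one linorder_not_less nat_neq_iff not_less)

lemma first_descent_exists:
  assumes "0 < n" "psum x n \<le> 0"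
  shows "\<exists>m\<in>{1..n}. first_descent x m"
proof -
  define m where "m = (LEAST m. 0 < m \<and> psum x m \<le> 0)"
  have "0 < m \<and> psum x m \<le> 0" unfolding m_def by (rule LeastI[of _ n]) (use assms in auto)
  moreover have "m \<le> n" unfolding m_def by (rule Least_le) (use assms in auto)
  moreover have "0 < psum x j" if "j \<in> {1..<m}" for j
    using not_less_Least[of j "\<lambda>m. 0 < m \<and> psum x m \<le> 0"] that unfolding m_def by auto
  ultimately show ?thesis unfolding first_descent_def by force
qed

lemma bij_rot: "bij (rot n a)"
proof (cases "n = 0")
  case True then have "rot n a = id" by (auto simp: rot_def fun_eq_iff)
  then show ?thesis by simp
next
  case False
  have mod_inj: "i = j" if "i \<le> j" "j < n" "(i + a) mod n = (j + a) mod n" for i j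
  proof -
    have "n dvd j - i"
      using mod_eq_dvd_iff_nat[of "i + a" "j + a" n] that by simp
    moreover have "j - i < n" using that by simp
    ultimately have "j - i = 0" using nat_dvd_not_less[of "j - i" n] by linarith
    then show ?thesis using that by simp
  qed
  have inj: "inj (rot n a)"
  proof (rule injI)
    fix i j assume e: "rot n a i = rot n a j"
    have "(k + a) mod n < n" for k using False by simp
    then consider "i < n" "j < n" "(i + a) mod n = (j + a) mod n" | "i = j"
      using e unfolding rot_def by metis
    then show "i = j"
    proof cases
      case 1
      then show ?thesis using mod_inj[of i j] mod_inj[of j i] by (cases "i \<le> j") auto
    qed simp
  qed
  have "rot n a ` {..<n} = {..<n}"
  proof (rule endo_inj_surj)
    show "rot n a ` {..<n} \<subseteq> {..<n}" using False by (auto simp: rot_def)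
    show "inj_on (rot n a) {..<n}" by (rule inj_on_subset[OF inj]) simp
  qed simp
  moreover have "rot n a ` {n..} = {n..}" by (auto simp: rot_def image_iff)
  moreover have "{..<n} \<union> {n..} = UNIV" by auto
  ultimately have "range (rot n a) = UNIV"
    using image_Un[of "rot n a" "{..<n}" "{n..}"] by simp
  then show ?thesis using inj by (simp add: bij_def)
qed

text \<open>Repeating the first \<open>n\<close> steps periodically turns rotation by
  \<open>a\<close> into a shift of the starting point, so all rotations are windows of one walk
  \<open>W\<close>.\<close>

lemma periodic_walk:
  fixes x :: "nat \<Rightarrow> real" and n :: nat
  defines "W \<equiv> psum (\<lambda>j. x (j mod n))"
  assumes "0 < n"
  shows "W (i + n) = W i + psum x n"
    and "j \<le> n \<Longrightarrow> psum (x \<circ> rot n a) j = W (a + j) - W a"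
proof -
  have "W n = psum x n" unfolding W_def by (rule psum_cong) simp
  moreover have "W (n + i) = W n + W i"
    unfolding W_def psum_shift by simp
  ultimately show "W (i + n) = W i + psum x n" by (simp add: add.commute)
  show "psum (x \<circ> rot n a) j = W (a + j) - W a" if "j \<le> n"
    unfolding W_def psum_shift using that by (auto intro!: psum_cong simp: rot_def add.commute)
qed

text \<open>If the total is nonpositive, the ladder epochs of the periodic extension of the walk cut
  the line into blocks of length at most \<open>n\<close>. The one pair \<open>(a, m)\<close> that contributes consists of
  the start and the length of the block containing the step from \<open>n\<close> to \<open>n + 1\<close>.\<close>
lemma rotation_unique:
  assumes n: "0 < n"
  shows "(\<Sum>a\<in>{1..n}. \<Sum>m\<in>{1..n}. of_bool (n < a + m \<and> first_descent (x \<circ> rot n a) m \<and> weak_record (x \<circ> rot n a) n)) =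
    (of_bool (psum x n \<le> 0) :: real)"
proof -
  define W where "W = psum (\<lambda>j. x (j mod n))"
  have per: "W (i + n) = W i + psum x n" for i
    unfolding W_def by (rule periodic_walk(1)[OF n])
  have rt: "psum (x \<circ> rot n a) j = W (a + j) - W a" if "j \<le> n" for a j
    unfolding W_def by (rule periodic_walk(2)[OF n that])
  define Q where "Q a m \<longleftrightarrow> n < a + m \<and> first_descent (x \<circ> rot n a) m \<and> weak_record (x \<circ> rot n a) n" for a m
  define good where "good a \<longleftrightarrow> (\<forall>j<n. W (a + n) \<le> W (a + j))" for a
  have rec: "weak_record (x \<circ> rot n a) n \<longleftrightarrow> good a" for a
    unfolding weak_record_def good_def by (auto simp: rt)
  have fd: "first_descent (x \<circ> rot n a) m \<longleftrightarrow> 0 < m \<and> W (a + m) \<le> W a \<and> (\<forall>j\<in>{1..<m}. W a < W (a + j))"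
    if "m \<le> n" for a m
    unfolding first_descent_def using that by (auto simp: rt)
  have sum_eq: "(\<Sum>a\<in>{1..n}. \<Sum>m\<in>{1..n}. of_bool (Q a m)) = (real (card {p \<in> {1..n} \<times> {1..n}. Q (fst p) (snd p)}))"
    by (subst sum.cartesian_product) (simp add: case_prod_unfold Int_def)
  have uniq: "a = a' \<and> m = m'" if q: "a \<in> {1..n}" "m \<in> {1..n}" "Q a m" "a' \<in> {1..n}" "m' \<in> {1..n}" "Q a' m'" for a m a' m'
  proof -
    \<comment> \<open>Since \<open>a' \<le> n < a + m\<close>, the time \<open>a'\<close> would lie
      inside the block starting at \<open>a\<close>, where the walk is strictly above
      \<open>W a\<close>; but \<open>good a'\<close> gives \<open>W a' \<le> W a\<close>.\<close>
    have *: "\<not> a < a'" if q: "a \<in> {1..n}" "m \<in> {1..n}" "Q a m" "a' \<in> {1..n}" "m' \<in> {1..n}" "Q a' m'" for a m a' m'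
    proof
      assume "a < a'"
      have "W (a' + n) \<le> W (a' + (a + n - a'))"
        using q(6) unfolding Q_def rec good_def
        by (elim conjE allE[of _ "a + n - a'"]) (use q \<open>a < a'\<close> in auto)
      also have "a' + (a + n - a') = a + n" using q by auto
      finally have "W a' \<le> W a" by (simp add: per)
      moreover have "W a < W (a + (a' - a))"
      proof -
        have "a' - a \<in> {1..<m}" using q \<open>a < a'\<close> unfolding Q_def by auto
        then show ?thesis using q fd[of m a] unfolding Q_def by (metis atLeastAtMost_iff)
      qed
      ultimately show False using \<open>a < a'\<close> by simp
    qed
    have "a = a'" using *[OF q] *[OF q(4-6,1-3)] by simp
    then show ?thesis using q first_descent_unique unfolding Q_def by blast
  qed
  show ?thesis
  proof (cases "psum x n \<le> 0")
    case True
    have "finite {a\<in>{1..n}. good a}" by simp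
    moreover have "{a\<in>{1..n}. good a} \<noteq> {}"
    proof -
      \<comment> \<open>A minimiser over the second period works: with a nonpositive total, no time
        in the first period lies lower, so the window of length \<open>n\<close> ending at
        \<open>b\<close> has its minimum at \<open>b\<close>.\<close>
      obtain b where b: "b \<in> {n+1..2*n}" and bmin: "\<And>i. i \<in> {n+1..2*n} \<Longrightarrow> W b \<le> W i"
      proof -
        have "Min (W ` {n+1..2*n}) \<in> W ` {n+1..2*n}" using n by (intro Min_in) auto
        then obtain b where "b \<in> {n+1..2*n}" "W b = Min (W ` {n+1..2*n})" by auto
        then show ?thesis using that[of b] by simp
      qed
      have "good (b - n)" unfolding good_def
      proof (intro allI impI)
        fix j assume j: "j < n"
        show "W (b - n + n) \<le> W (b - n + j)"
        proof (cases "b - n + j \<le> n")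
          case True
          have "W b \<le> W (b - n + j + n)" by (rule bmin) (use True b in auto)
          also have "\<dots> \<le> W (b - n + j)" unfolding per using \<open>psum x n \<le> 0\<close> by simp
          finally show ?thesis using b by simp
        next
          case False
          then show ?thesis using b j by (auto intro!: bmin)
        qed
      qed
      then show ?thesis using b by (auto intro!: exI[of _ "b - n"])
    qed
    \<comment> \<open>For the largest good \<open>a\<close> the block must cross \<open>n\<close>:
      if it ended at \<open>a + m \<le> n\<close>, then \<open>a + m\<close> would be a larger good
      start.\<close>
    ultimately obtain a where a: "a \<in> {1..n}" "good a" and amax: "\<And>a'. a' \<in> {1..n} \<Longrightarrow> good a' \<Longrightarrow> a' \<le> a"
      using Max_in[of "{a\<in>{1..n}. good a}"] Max_ge[of "{a\<in>{1..n}. good a}"] by blast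
    have "psum (x \<circ> rot n a) n \<le> 0" using rt[of n a] per[of a] True by simp
    then obtain m where m: "m \<in> {1..n}" "first_descent (x \<circ> rot n a) m"
      using first_descent_exists[OF n] by blast
    have "n < a + m"
    proof (rule ccontr)
      assume nl: "\<not> n < a + m"
      have mm: "0 < m" "W (a + m) \<le> W a" "\<And>j. j \<in> {1..<m} \<Longrightarrow> W a < W (a + j)"
        using m fd[of m a] by auto
      have "good (a + m)" unfolding good_def
      proof (intro allI impI)
        fix j assume j: "j < n"
        show "W (a + m + n) \<le> W (a + m + j)"
        proof (cases "m + j < n")
          case True
          have "W (a + m + n) \<le> W (a + n)" using mm(2) by (simp add: per)
          also have "\<dots> \<le> W (a + (m + j))" using a(2) True unfolding good_def by blast
          finally show ?thesis by (simp add: add.assoc)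
        next
          case False
          define i where "i = m + j - n"
          have i: "i < m" "m + j = i + n" using False j unfolding i_def by auto
          have "W (a + m) \<le> W (a + i)" using mm(2) mm(3)[of i] i by (cases "i = 0") auto
          then have "W (a + m + n) \<le> W (a + i + n)" by (simp add: per)
          then show ?thesis using i by (simp add: add.assoc)
        qed
      qed
      then show False using amax[of "a + m"] nl mm(1) by auto
    qed
    then have "Q a m" unfolding Q_def rec using m a by simp
    have "{p \<in> {1..n} \<times> {1..n}. Q (fst p) (snd p)} = {(a, m)}"
    proof (intro equalityI subsetI)
      fix p assume "p \<in> {p \<in> {1..n} \<times> {1..n}. Q (fst p) (snd p)}"
      then show "p \<in> {(a, m)}"
        using uniq[of "fst p" "snd p" a m] a(1) m(1) \<open>Q a m\<close> by (cases p) simp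
    qed (use a(1) m(1) \<open>Q a m\<close> in simp)
    then show ?thesis using sum_eq True unfolding Q_def by simp
  next
    case False
    have "\<not> Q a m" for a m
      unfolding Q_def rec good_def using False n per[of a] by (force dest: spec[of _ 0])
    then show ?thesis unfolding Q_def[symmetric] using False by simp
  qed
qed

lemma (in prob_space) expectation_of_bool:
  assumes "Measurable.pred M P"
  shows "expectation (\<lambda>\<omega>. of_bool (P \<omega>)) = prob {\<omega> \<in> space M. P \<omega>}"
    and "integrable M (\<lambda>\<omega>. of_bool (P \<omega>) :: real)"
proof -
  have A: "{\<omega> \<in> space M. P \<omega>} \<in> events" using assms by (simp add: pred_def)
  have "expectation (\<lambda>\<omega>. of_bool (P \<omega>)) = expectation (indicator {\<omega> \<in> space M. P \<omega>})"
    by (rule Bochner_Integration.integral_cong) (auto simp: indicator_def)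
  also have "\<dots> = prob ({\<omega> \<in> space M. P \<omega>} \<inter> space M)" by (rule Bochner_Integration.integral_indicator)
  also have "{\<omega> \<in> space M. P \<omega>} \<inter> space M = {\<omega> \<in> space M. P \<omega>}" by auto
  finally show "expectation (\<lambda>\<omega>. of_bool (P \<omega>)) = prob {\<omega> \<in> space M. P \<omega>}" .
  have "integrable M (indicator {\<omega> \<in> space M. P \<omega>} :: _ \<Rightarrow> real)"
    using A by (intro integrable_real_indicator) (auto simp: emeasure_eq_measure)
  then show "integrable M (\<lambda>\<omega>. of_bool (P \<omega>) :: real)"
    by (rule Bochner_Integration.integrable_cong[THEN iffD1, rotated 2]) (auto simp: indicator_def)
qed

section \<open>Renewal and rotation identities for i.i.d. steps\<close>

locale iid_walk = sequence_space N for N :: "real measure" +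
  assumes sets_N [simp]: "sets N = sets borel"
begin

definition f where "f m = measure S {\<omega> \<in> space S. first_descent \<omega> m}"
definition u where "u n = measure S {\<omega> \<in> space S. weak_record \<omega> n}"
definition b where "b n = measure S {\<omega> \<in> space S. psum \<omega> n \<le> 0}"

lemma space_N [simp]: "space N = UNIV"
  using sets_eq_imp_space_eq[OF sets_N] by simp

lemma space_S [simp]: "space S = UNIV"
  by (simp add: space_PiM)

lemma psum_measurable [measurable]: "(\<lambda>\<omega>. psum \<omega> n) \<in> borel_measurable S"
  unfolding psum_def by (intro borel_measurable_sum) (simp add: measurable_cong_sets[OF refl sets_N, symmetric])

lemma first_descent_measurable [measurable]: "Measurable.pred S (\<lambda>\<omega>. first_descent \<omega> m)"
  unfolding first_descent_def by measurable

lemma weak_record_measurable [measurable]: "Measurable.pred S (\<lambda>\<omega>. weak_record \<omega> m)"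
proof -
  have "weak_record \<omega> m \<longleftrightarrow> (\<forall>j\<in>{..<m}. psum \<omega> m - psum \<omega> j \<le> 0)" for \<omega>
    by (auto simp: weak_record_def)
  then have "(\<lambda>\<omega>. weak_record \<omega> m) = (\<lambda>\<omega>. \<forall>j\<in>{..<m}. psum \<omega> m - psum \<omega> j \<le> 0)"
    by (rule ext)
  then show ?thesis by (simp only:) measurable
qed

text \<open>At its first descent the walk is no higher than at any earlier time, so whether
  \<open>n\<close> is a weak record depends only on the steps after \<open>m\<close>. Splicing two
  independent copies with \<open>comb_seq\<close> then factorises the probability.\<close>

lemma prob_regeneration:
  assumes m: "1 \<le> m" "m \<le> n"
  shows "measure S {\<omega> \<in> space S. first_descent \<omega> m \<and> weak_record \<omega> n} = f m * u (n - m)"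
proof -
  let ?A = "{\<omega> \<in> space S. first_descent \<omega> m}" and ?B = "{\<omega> \<in> space S. weak_record \<omega> (n - m)}"
  let ?C = "{\<omega> \<in> space S. first_descent \<omega> m \<and> weak_record \<omega> n}"
  have [measurable]: "?A \<in> sets S" "?B \<in> sets S" "?C \<in> sets S"
    by measurable
  have p1: "psum (comb_seq m \<omega> \<omega>') j = psum \<omega> j" if "j \<le> m" for \<omega> \<omega>' j
    using that by (intro psum_cong) (auto simp: comb_seq_def)
  have p2: "psum (comb_seq m \<omega> \<omega>') (m + j) = psum \<omega> m + psum \<omega>' j" for \<omega> \<omega>' j
    unfolding psum_shift p1[OF order_refl] by (simp add: comb_seq_def)
  have fd: "first_descent (comb_seq m \<omega> \<omega>') m \<longleftrightarrow> first_descent \<omega> m" for \<omega> \<omega>'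
    unfolding first_descent_def by (auto simp: p1)
  have wr: "weak_record (comb_seq m \<omega> \<omega>') n \<longleftrightarrow> weak_record \<omega>' (n - m)" if d: "first_descent \<omega> m" for \<omega> \<omega>'
  proof
    assume w: "weak_record (comb_seq m \<omega> \<omega>') n"
    show "weak_record \<omega>' (n - m)" unfolding weak_record_def
    proof (intro allI impI)
      fix j assume "j < n - m"
      then have "psum (comb_seq m \<omega> \<omega>') (m + (n - m)) \<le> psum (comb_seq m \<omega> \<omega>') (m + j)"
        using w m unfolding weak_record_def by auto
      then show "psum \<omega>' (n - m) \<le> psum \<omega>' j" unfolding p2 by simp
    qed
  next
    assume w: "weak_record \<omega>' (n - m)"
    show "weak_record (comb_seq m \<omega> \<omega>') n" unfolding weak_record_def
    proof (intro allI impI)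
      fix j assume j: "j < n"
      have n: "psum (comb_seq m \<omega> \<omega>') n = psum \<omega> m + psum \<omega>' (n - m)"
        using p2[of \<omega> \<omega>' "n - m"] m by simp
      have 0: "psum \<omega>' (n - m) \<le> 0"
        using w unfolding weak_record_def by (cases "n = m") (auto dest: spec[of _ 0])
      show "psum (comb_seq m \<omega> \<omega>') n \<le> psum (comb_seq m \<omega> \<omega>') j"
      proof (cases "j < m")
        case True
        have "psum \<omega> m \<le> psum \<omega> j"
          using d True unfolding first_descent_def by (cases "j = 0") (auto dest!: bspec[of _ _ j])
        then show ?thesis using n 0 p1[of j] True by simp
      next
        case False
        then show ?thesis using n p2[of \<omega> \<omega>' "j - m"] w j m unfolding weak_record_def by auto
      qed
    qed
  qed
  have "emeasure S ?C = emeasure (distr (S \<Otimes>\<^sub>M S) S (\<lambda>(\<omega>, \<omega>'). comb_seq m \<omega> \<omega>')) ?C"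
    by (simp add: PiM_comb_seq)
  also have "\<dots> = emeasure (S \<Otimes>\<^sub>M S) ((\<lambda>(\<omega>, \<omega>'). comb_seq m \<omega> \<omega>') -` ?C \<inter> space (S \<Otimes>\<^sub>M S))"
    by (rule emeasure_distr[OF measurable_comb_seq]) measurable
  also have "(\<lambda>(\<omega>, \<omega>'). comb_seq m \<omega> \<omega>') -` ?C \<inter> space (S \<Otimes>\<^sub>M S) = ?A \<times> ?B"
    by (auto simp: space_pair_measure fd wr)
  also have "emeasure (S \<Otimes>\<^sub>M S) (?A \<times> ?B) = emeasure S ?A * emeasure S ?B"
    by (rule P.emeasure_pair_measure_Times) measurable
  finally show ?thesis
    unfolding f_def u_def measure_def by (simp add: enn2real_mult)
qed

lemma distr_rot: "distr S S (\<lambda>\<omega>. \<omega> \<circ> rot n a) = S"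
proof -
  have "distr (PiM UNIV (\<lambda>_. N)) (\<Pi>\<^sub>M i\<in>UNIV. N) (\<lambda>\<omega>. \<lambda>i\<in>UNIV. \<omega> (rot n a i)) = (\<Pi>\<^sub>M i\<in>UNIV. N)"
    by (rule distr_PiM_reindex) (use bij_rot[of n a] in \<open>auto simp: bij_def prob_space_axioms intro: M.prob_space_axioms\<close>)
  then show ?thesis by (simp add: comp_def restrict_UNIV)
qed

lemma rot_measurable [measurable]: "(\<lambda>\<omega>. \<omega> \<circ> rot n a) \<in> measurable S S"
  unfolding comp_def by (rule measurable_PiM_single') auto

lemma prob_rot:
  assumes [measurable]: "Measurable.pred S P"
  shows "measure S {\<omega> \<in> space S. P (\<omega> \<circ> rot n a)} = measure S {\<omega> \<in> space S. P \<omega>}"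
proof -
  have "measure S {\<omega> \<in> space S. P \<omega>} = measure (distr S S (\<lambda>\<omega>. \<omega> \<circ> rot n a)) {\<omega> \<in> space S. P \<omega>}"
    by (simp add: distr_rot)
  also have "\<dots> = measure S ((\<lambda>\<omega>. \<omega> \<circ> rot n a) -` {\<omega> \<in> space S. P \<omega>} \<inter> space S)"
    by (rule measure_distr) measurable
  finally show ?thesis by (simp add: vimage_def)
qed

lemma u_0 [simp]: "u 0 = 1"
  using P.prob_space unfolding u_def weak_record_def by simp

text \<open>A weak record at \<open>n > 0\<close> lies at or below the origin, so exactly one first
  descent occurs by time \<open>n\<close>; the sum classifies the records by it.\<close>

lemma u_renewal:
  assumes n: "0 < n"
  shows "u n = (\<Sum>m\<in>{1..n}. f m * u (n - m))"
proof -
  have *: "of_bool (weak_record \<omega> n) = (\<Sum>m\<in>{1..n}. of_bool (first_descent \<omega> m \<and> weak_record \<omega> n) :: real)" for \<omega>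
  proof (cases "weak_record \<omega> n")
    case True
    then have "psum \<omega> n \<le> 0" using n unfolding weak_record_def by (auto dest: spec[of _ 0])
    then obtain m where m: "m \<in> {1..n}" "first_descent \<omega> m" using first_descent_exists[OF n] by blast
    then have "{1..n} \<inter> {m. first_descent \<omega> m} = {m}" using first_descent_unique by auto
    then show ?thesis using True by simp
  qed simp
  have "u n = (LINT \<omega>|S. (\<Sum>m\<in>{1..n}. of_bool (first_descent \<omega> m \<and> weak_record \<omega> n)))"
    unfolding u_def * [symmetric] by (rule P.expectation_of_bool(1)[symmetric]) measurable
  also have "\<dots> = (\<Sum>m\<in>{1..n}. measure S {\<omega> \<in> space S. first_descent \<omega> m \<and> weak_record \<omega> n})"
    by (subst Bochner_Integration.integral_sum)
       (auto intro!: sum.cong P.expectation_of_bool simp del: space_S of_bool_conj)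
  also have "\<dots> = (\<Sum>m\<in>{1..n}. f m * u (n - m))"
    by (rule sum.cong) (auto simp: prob_regeneration simp del: space_S)
  finally show ?thesis .
qed

text \<open>The expectation of \<open>rotation_unique\<close>: rotation preserves the law, so every
  admissible \<open>a\<close> contributes the same probability. The factor \<open>m\<close> counts
  the \<open>a\<close> with \<open>n - m < a \<le> n\<close>.\<close>

lemma b_rotation:
  assumes n: "0 < n"
  shows "b n = (\<Sum>m\<in>{1..n}. real m * f m * u (n - m))"
proof -
  let ?E = "\<lambda>\<omega> m. first_descent \<omega> m \<and> weak_record \<omega> n"
  have "b n = (LINT \<omega>|S. of_bool (psum \<omega> n \<le> 0))"
    unfolding b_def by (rule P.expectation_of_bool(1)[symmetric]) measurable
  also have "\<dots> = (LINT \<omega>|S. (\<Sum>a\<in>{1..n}. \<Sum>m\<in>{1..n}. of_bool (n < a + m \<and> ?E (\<omega> \<circ> rot n a) m)))"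
    by (simp only: rotation_unique[OF n])
  also have "\<dots> = (\<Sum>a\<in>{1..n}. \<Sum>m\<in>{1..n}. measure S {\<omega> \<in> space S. n < a + m \<and> ?E (\<omega> \<circ> rot n a) m})"
    by (subst Bochner_Integration.integral_sum, (intro Bochner_Integration.integrable_sum P.expectation_of_bool(2); measurable),
        intro sum.cong refl, subst Bochner_Integration.integral_sum, (intro P.expectation_of_bool(2); measurable),
        intro sum.cong refl P.expectation_of_bool(1), measurable)
  also have "\<dots> = (\<Sum>a\<in>{1..n}. \<Sum>m\<in>{1..n}. of_bool (n < a + m) * (f m * u (n - m)))"
  proof (intro sum.cong refl)
    fix a m assume m: "m \<in> {1..n}"
    have "measure S {\<omega> \<in> space S. ?E (\<omega> \<circ> rot n a) m} = f m * u (n - m)"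
      by (subst prob_rot[of "\<lambda>\<omega>. ?E \<omega> m"]) (use m in \<open>auto simp: prob_regeneration simp del: space_S\<close>)
    then show "measure S {\<omega> \<in> space S. n < a + m \<and> ?E (\<omega> \<circ> rot n a) m} = of_bool (n < a + m) * (f m * u (n - m))"
      by (cases "n < a + m") (simp_all del: space_S)
  qed
  also have "\<dots> = (\<Sum>m\<in>{1..n}. \<Sum>a\<in>{1..n}. of_bool (n < a + m) * (f m * u (n - m)))"
    by (rule sum.swap)
  also have "\<dots> = (\<Sum>m\<in>{1..n}. real m * f m * u (n - m))"
  proof (intro sum.cong refl)
    fix m assume m: "m \<in> {1..n}"
    have "{1..n} \<inter> {a. n < a + m} = {n - m <.. n}" using m by auto
    then have "(\<Sum>a\<in>{1..n}. of_bool (n < a + m) :: real) = real m" using m by simp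
    then show "(\<Sum>a\<in>{1..n}. of_bool (n < a + m) * (f m * u (n - m))) = real m * f m * u (n - m)"
      by (simp only: sum_distrib_right[symmetric] mult.assoc)
  qed
  finally show ?thesis .
qed

lemma f_0 [simp]: "f 0 = 0" by (simp add: f_def first_descent_def)
lemma f_nonneg: "0 \<le> f n" by (simp add: f_def)
lemma f_le: "f n \<le> 1" by (simp add: f_def)
lemma u_nonneg: "0 \<le> u n" by (simp add: u_def)
lemma u_le: "u n \<le> 1" by (simp add: u_def)
lemma b_nonneg: "0 \<le> b n" by (simp add: b_def)
lemma b_le: "b n \<le> 1" by (simp add: b_def)

end

section \<open>The Sparre Andersen identity\<close>

lemma conv_radius_bounded:
  fixes c :: "nat \<Rightarrow> real"
  assumes "\<And>n. \<bar>c n\<bar> \<le> 1"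
  shows "1 \<le> fps_conv_radius (Abs_fps c)"
  unfolding fps_conv_radius_def
proof (rule conv_radius_geI_ex)
  fix r :: real assume r: "0 < r" "ereal r < 1"
  have "summable (\<lambda>n. fps_nth (Abs_fps c) n * r ^ n)"
    by (rule summable_comparison_test'[OF summable_geometric[of r], of 0])
       (use r assms in \<open>auto simp: abs_mult intro!: mult_left_le_one_le\<close>)
  then show "\<exists>z. norm z = r \<and> summable (\<lambda>n. fps_nth (Abs_fps c) n * z ^ n)"
    using r by (intro exI[of _ r]) auto
qed

text \<open>With \<open>F\<close>, \<open>U\<close>, \<open>B\<close> the generating functions of \<open>f\<close>, \<open>u\<close>, \<open>b n / n\<close>, the recursions say
  \<open>U = 1 + F U\<close> and \<open>B' = F' U\<close>, so \<open>(1 - F) exp B\<close> has derivative zero.\<close>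
lemma renewal_exp:
  fixes f u b :: "nat \<Rightarrow> real"
  assumes f: "f 0 = 0" "\<And>n. \<bar>f n\<bar> \<le> 1" and u: "u 0 = 1" "\<And>n. \<bar>u n\<bar> \<le> 1" and b: "\<And>n. \<bar>b n\<bar> \<le> 1"
    and u_rec: "\<And>n. 0 < n \<Longrightarrow> u n = (\<Sum>m\<in>{1..n}. f m * u (n - m))"
    and b_rec: "\<And>n. 0 < n \<Longrightarrow> b n = (\<Sum>m\<in>{1..n}. real m * f m * u (n - m))"
    and s: "0 \<le> s" "s < 1"
  shows "1 - (\<Sum>n. f n * s ^ n) = exp (- (\<Sum>n. b n / real n * s ^ n))"
proof -
  define F where "F = Abs_fps f"
  define U where "U = Abs_fps u"
  define B where "B = Abs_fps (\<lambda>n. b n / real n)"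
  have b': "\<bar>b n / real n\<bar> \<le> 1" for n
    using b[of n] by (cases "n = 0") (auto simp: divide_le_eq intro: order_trans)
  have rad: "1 \<le> fps_conv_radius F" "1 \<le> fps_conv_radius U" "1 \<le> fps_conv_radius B"
    unfolding F_def U_def B_def using f u b' by (auto intro!: conv_radius_bounded)
  have U: "U = 1 + F * U"
  proof (rule fps_ext)
    fix n show "fps_nth U n = fps_nth (1 + F * U) n"
      by (cases "n = 0") (auto simp: U_def F_def fps_mult_nth u u_rec f sum.atLeast_Suc_atMost[of 0 n])
  qed
  \<comment> \<open>Multiplication by \<open>fps_X\<close> aligns the indices: for
    \<open>n > 0\<close> the coefficient of \<open>fps_X * fps_deriv B\<close> is
    \<open>b n\<close>, the left side of \<open>b_rec\<close>.\<close>
  have B: "fps_X * fps_deriv B = fps_X * fps_deriv F * U"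
  proof (rule fps_ext)
    fix n show "fps_nth (fps_X * fps_deriv B) n = fps_nth (fps_X * fps_deriv F * U) n"
    proof (cases "n = 0")
      case False
      have "fps_nth (fps_X * fps_deriv B) n = b n" using False by (simp add: B_def)
      also have "\<dots> = (\<Sum>m\<in>{1..n}. real m * f m * u (n - m))" using False b_rec by simp
      also have "\<dots> = (\<Sum>m\<in>{0..n}. fps_nth (fps_X * fps_deriv F) m * fps_nth U (n - m))"
        by (subst sum.atLeast_Suc_atMost[of 0 n]) (auto simp: F_def U_def intro!: sum.cong)
      finally show ?thesis by (simp only: fps_mult_nth)
    qed simp
  qed
  have "fps_X * fps_deriv B = fps_X * (fps_deriv F * U)" using B by (simp only: mult.assoc)
  then have B': "fps_deriv B = fps_deriv F * U" by (metis fps_X_neq_zero mult_left_cancel)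
  define g where "g z = (1 - eval_fps F z) * exp (eval_fps B z)" for z :: real
  have deriv0: "(g has_field_derivative 0) (at z within {0..s})" if z: "z \<in> {0..s}" for z
  proof -
    have z1: "ereal (norm z) < 1" using z s by auto
    then have lt: "ereal (norm z) < fps_conv_radius F" "ereal (norm z) < fps_conv_radius U"
      "ereal (norm z) < fps_conv_radius B" using less_le_trans[OF z1] rad by blast+
    have ltF: "ereal (norm z) < fps_conv_radius (fps_deriv F)"
      by (rule less_le_trans[OF lt(1) fps_conv_radius_deriv])
    have "(g has_field_derivative (1 - eval_fps F z) * (exp (eval_fps B z) * eval_fps (fps_deriv B) z)
        - eval_fps (fps_deriv F) z * exp (eval_fps B z)) (at z within {0..s})"
      unfolding g_def using lt
      by (auto intro!: derivative_eq_intros has_field_derivative_eval_fps simp: algebra_simps)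
    also have "eval_fps (fps_deriv B) z = eval_fps (fps_deriv F) z * eval_fps U z"
      unfolding B' by (rule eval_fps_mult[OF ltF lt(2)])
    also have "(1 - eval_fps F z) * (exp (eval_fps B z) * (eval_fps (fps_deriv F) z * eval_fps U z))
        - eval_fps (fps_deriv F) z * exp (eval_fps B z)
        = eval_fps (fps_deriv F) z * exp (eval_fps B z) * (eval_fps U z - eval_fps F z * eval_fps U z - 1)"
      by (simp add: algebra_simps)
    also have "eval_fps U z = 1 + eval_fps F z * eval_fps U z"
    proof -
      have "ereal (norm z) < fps_conv_radius (F * U)"
        using less_le_trans[OF _ fps_conv_radius_mult[of F U]] lt(1,2) by simp
      then show ?thesis using arg_cong[OF U, of "\<lambda>x. eval_fps x z"] lt
        by (simp add: eval_fps_add eval_fps_mult)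
    qed
    then have "eval_fps U z - eval_fps F z * eval_fps U z - 1 = 0" by simp
    finally show ?thesis by simp
  qed
  have "g s = g 0"
    using has_field_derivative_zero_constant[of "{0..s}" g] deriv0 s
    by (metis atLeastAtMost_iff convex_real_interval(5) order_refl)
  \<comment> \<open>Both constant terms vanish: \<open>f 0 = 0\<close> by assumption, and
    \<open>b 0 / real 0 = 0\<close> by the convention for division.\<close>
  also have "g 0 = 1" by (simp add: g_def eval_fps_at_0 F_def B_def f)
  finally have "(1 - eval_fps F s) * exp (eval_fps B s) = 1" by (simp add: g_def)
  then have "1 - eval_fps F s = exp (- eval_fps B s)" by (simp add: exp_minus field_simps)
  then show ?thesis by (simp add: eval_fps_def F_def B_def)
qed

text \<open>Abel's limit theorem in the easy case: nonnegative summable coefficients make the series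
  converge uniformly on the closed unit interval.\<close>

lemma power_series_tendsto_left:
  fixes a :: "nat \<Rightarrow> real"
  assumes a: "\<And>n. 0 \<le> a n" "summable a"
  shows "((\<lambda>s. \<Sum>n. a n * s ^ n) \<longlongrightarrow> suminf a) (at_left 1)"
proof -
  have "uniform_limit {0..1} (\<lambda>n s. \<Sum>i<n. a i * s ^ i) (\<lambda>s. \<Sum>i. a i * s ^ i) sequentially"
    by (rule Weierstrass_m_test[OF _ a(2)]) (auto simp: abs_mult a intro!: mult_right_le_one_le power_le_one)
  then have "continuous_on {0..1} (\<lambda>s. \<Sum>i. a i * s ^ i)"
    by (rule uniform_limit_theorem[rotated]) (auto intro!: always_eventually continuous_intros)
  then have "((\<lambda>s. \<Sum>n. a n * s ^ n) \<longlongrightarrow> (\<Sum>n. a n * 1 ^ n)) (at 1 within {0..1})"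
    unfolding continuous_on_def by (elim ballE[of _ _ 1]) auto
  then show ?thesis by (simp add: at_within_Icc_at_left)
qed

lemma summable_mult_power:
  fixes a :: "nat \<Rightarrow> real"
  assumes "\<And>n. \<bar>a n\<bar> \<le> 1" "0 \<le> s" "s < 1"
  shows "summable (\<lambda>n. a n * s ^ n)"
  by (rule summable_comparison_test'[OF summable_geometric[of s], of 0])
     (use assms in \<open>auto simp: abs_mult intro!: mult_left_le_one_le\<close>)

text \<open>The logarithmic series, as the renewal process that renews at every step.\<close>
lemma one_minus_eq_exp:
  fixes s :: real
  assumes "0 \<le> s" "s < 1"
  shows "1 - s = exp (- (\<Sum>n. 1 / real n * s ^ n))"
proof -
  have *: "(\<Sum>m\<in>{1..n}. of_bool (m = 1) * c m) = (c 1 :: real)" if "0 < n" for n :: nat and c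
    using that by (subst sum.remove[of "{1..n}" 1]) auto
  have "1 - (\<Sum>n. of_bool (n = 1) * s ^ n) = exp (- (\<Sum>n. 1 / real n * s ^ n))"
    by (rule renewal_exp[where u = "\<lambda>_. 1"])
       (use assms *[of _ "\<lambda>_. 1"] *[of _ real] in \<open>auto simp: mult.commute\<close>)
  moreover have "(\<Sum>n. of_bool (n = 1) * s ^ n) = s"
    by (subst suminf_finite[of "{1}"]) auto
  ultimately show ?thesis by simp
qed

section \<open>Probability of no descent and mean time of descent\<close>

context iid_walk
begin

definition p where "p n = measure S {\<omega> \<in> space S. \<forall>j\<in>{1..n}. 0 < psum \<omega> j}"

lemma one_minus_f_series: 
  assumes "0 \<le> s" "s < 1"
  shows "1 - (\<Sum>n. f n * s ^ n) = exp (- (\<Sum>n. b n / real n * s ^ n))"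
  by (rule renewal_exp[where u = u])
     (use assms u_renewal b_rotation f_nonneg f_le u_nonneg u_le b_nonneg b_le in auto)

lemma first_descent_sets [measurable]: "{\<omega> \<in> space S. first_descent \<omega> m} \<in> sets S"
  by measurable

lemma not_first_descent_iff: "(\<forall>j\<in>{1..n}. 0 < psum \<omega> j) \<longleftrightarrow> \<not> (\<exists>m\<in>{1..n}. first_descent \<omega> m)"
proof
  assume "\<forall>j\<in>{1..n}. 0 < psum \<omega> j"
  then show "\<not> (\<exists>m\<in>{1..n}. first_descent \<omega> m)" unfolding first_descent_def by (auto simp: not_le[symmetric])
next
  assume *: "\<not> (\<exists>m\<in>{1..n}. first_descent \<omega> m)"
  show "\<forall>j\<in>{1..n}. 0 < psum \<omega> j"
  proof (rule ballI, rule ccontr)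
    fix j assume "j \<in> {1..n}" "\<not> 0 < psum \<omega> j"
    then show False using first_descent_exists[of j \<omega>] * by force
  qed
qed

lemma f_sums: "f sums measure S {\<omega> \<in> space S. \<exists>m. first_descent \<omega> m}"
proof -
  have "(\<lambda>m. measure S {\<omega> \<in> space S. first_descent \<omega> m}) sums measure S (\<Union>m. {\<omega> \<in> space S. first_descent \<omega> m})"
    by (rule P.finite_measure_UNION) (auto simp: disjoint_family_on_def dest: first_descent_unique simp del: space_S)
  moreover have "(\<Union>m. {\<omega> \<in> space S. first_descent \<omega> m}) = {\<omega> \<in> space S. \<exists>m. first_descent \<omega> m}" by auto
  ultimately show ?thesis by (simp add: f_def[abs_def])
qed

lemma p_eq: "p n = 1 - (\<Sum>m\<in>{0..n}. f m)"
proof -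
  have "{\<omega> \<in> space S. \<forall>j\<in>{1..n}. 0 < psum \<omega> j} = space S - (\<Union>m\<in>{1..n}. {\<omega> \<in> space S. first_descent \<omega> m})"
    by (auto simp: not_first_descent_iff simp del: atLeastAtMost_iff One_nat_def)
  moreover have "measure S (\<Union>m\<in>{1..n}. {\<omega> \<in> space S. first_descent \<omega> m}) = (\<Sum>m\<in>{1..n}. f m)"
    unfolding f_def by (rule P.finite_measure_finite_Union)
      (auto simp: disjoint_family_on_def dest: first_descent_unique simp del: space_S)
  ultimately have "p n = 1 - (\<Sum>m\<in>{1..n}. f m)"
    using P.prob_compl[of "\<Union>m\<in>{1..n}. {\<omega> \<in> space S. first_descent \<omega> m}"]
    unfolding p_def by (simp del: space_S)
  then show ?thesis by (simp add: sum.atLeast_Suc_atMost[of 0 n])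
qed

lemma p_nonneg: "0 \<le> p n" by (simp add: p_def)
lemma p_le: "p n \<le> 1" by (simp add: p_def)

text \<open>Letting \<open>s\<close> tend to 1 in \<open>one_minus_f_series\<close> turns the left
  side into one minus the probability of ever descending; summability gives the exponent on the
  right its finite limit.\<close>

lemma prob_never_descends:
  assumes sm: "summable (\<lambda>n. b n / real n)"
  shows "measure S {\<omega> \<in> space S. \<forall>n\<ge>1. 0 < psum \<omega> n} = exp (- (\<Sum>n. b n / real n))"
proof -
  have t1: "((\<lambda>s. 1 - (\<Sum>n. f n * s ^ n)) \<longlongrightarrow> 1 - suminf f) (at_left 1)"
    by (intro tendsto_intros power_series_tendsto_left f_nonneg sums_summable[OF f_sums])
  have t2: "((\<lambda>s. exp (- (\<Sum>n. b n / real n * s ^ n))) \<longlongrightarrow> exp (- (\<Sum>n. b n / real n))) (at_left 1)"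
    by (intro tendsto_intros power_series_tendsto_left sm) (simp add: b_nonneg)
  have ev: "\<forall>\<^sub>F s in at_left 1. exp (- (\<Sum>n. b n / real n * s ^ n)) = 1 - (\<Sum>n. f n * s ^ n)"
    using eventually_at_left_real[of 0 1] by (rule eventually_mono) (auto simp: one_minus_f_series)
  have "1 - suminf f = exp (- (\<Sum>n. b n / real n))"
    by (rule tendsto_unique[OF trivial_limit_at_left_real t1 Lim_transform_eventually[OF t2 ev]])
  moreover have "{\<omega> \<in> space S. \<forall>n\<ge>1. 0 < psum \<omega> n} = space S - {\<omega> \<in> space S. \<exists>m. first_descent \<omega> m}"
  proof -
    have "(\<forall>n\<ge>1. 0 < psum \<omega> n) \<longleftrightarrow> (\<forall>n. \<forall>j\<in>{1..n}. 0 < psum \<omega> j)" for \<omega>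
      by (meson atLeastAtMost_iff order_refl)
    moreover have "(\<exists>m. first_descent \<omega> m) \<longleftrightarrow> (\<exists>n. \<exists>m\<in>{1..n}. first_descent \<omega> m)" for \<omega>
    proof -
      have "1 \<le> m" if "first_descent \<omega> m" for m using that by (simp add: first_descent_def Suc_le_eq)
      then show ?thesis by (meson atLeastAtMost_iff order_refl)
    qed
    ultimately show ?thesis by (auto simp: not_first_descent_iff simp del: atLeastAtMost_iff One_nat_def)
  qed
  moreover have "{\<omega> \<in> space S. \<exists>m. first_descent \<omega> m} \<in> sets S" by measurable
  ultimately show ?thesis using sums_unique[OF f_sums] by (simp add: P.prob_compl del: space_S)
qed

text \<open>The mean of the descent time T is the sum of its tails \<open>p n\<close> = P(T > n).
  Cutting the sum at an arbitrary \<open>K\<close> makes the passage \<open>s\<close> to 1 a limit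
  of finite sums, with a bound independent of \<open>K\<close>.\<close>

lemma sum_survival_le:
  assumes sm: "summable (\<lambda>n. (1 - b n) / real n)"
  shows "(\<Sum>n<K. p n) \<le> exp (\<Sum>n. (1 - b n) / real n)"
proof -
  have le: "(\<Sum>n<K. p n * s ^ n) \<le> exp (\<Sum>n. (1 - b n) / real n)" if s: "0 < s" "s < 1" for s
  proof -
    have b1: "\<bar>b n / real n\<bar> \<le> 1" "\<bar>1 / real n\<bar> \<le> 1" for n
      using b_nonneg[of n] b_le[of n] by (cases "n = 0"; force simp: divide_le_eq)+
    have smp: "summable (\<lambda>n. p n * s ^ n)" and smf: "summable (\<lambda>n. f n * s ^ n)"
      and smb: "summable (\<lambda>n. b n / real n * s ^ n)" "summable (\<lambda>n. 1 / real n * s ^ n)"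
      using s p_nonneg p_le f_nonneg f_le summable_mult_power[OF b1(1)] summable_mult_power[OF b1(2)]
      by (auto intro!: summable_mult_power)
    \<comment> \<open>Summation by parts, from \<open>p (Suc n) = p n - f (Suc n)\<close> and
      \<open>p 0 = 1\<close>.\<close>
    have "(1 - s) * (\<Sum>n. p n * s ^ n) = 1 - (\<Sum>n. f n * s ^ n)"
    proof -
      have "(\<Sum>n. p n * s ^ n) = p 0 + (\<Sum>n. p (Suc n) * s ^ n) * s"
        by (rule powser_split_head(1)[OF smp])
      moreover have "(\<Sum>n. f n * s ^ n) = f 0 + (\<Sum>n. f (Suc n) * s ^ n) * s"
        by (rule powser_split_head(1)[OF smf])
      moreover have "(\<Sum>n. p (Suc n) * s ^ n) = (\<Sum>n. p n * s ^ n) - (\<Sum>n. f (Suc n) * s ^ n)"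
      proof -
        have "summable (\<lambda>n. f (Suc n) * s ^ n)"
          using s f_nonneg f_le by (intro summable_mult_power) auto
        moreover have "p (Suc n) * s ^ n = p n * s ^ n - f (Suc n) * s ^ n" for n
          by (simp add: p_eq algebra_simps)
        ultimately show ?thesis using suminf_diff[OF smp] by simp
      qed
      moreover have "p 0 = 1" by (simp add: p_eq)
      ultimately show ?thesis unfolding f_0 by algebra
    qed
    also have "\<dots> = exp (- (\<Sum>n. b n / real n * s ^ n))" using one_minus_f_series s by simp
    finally have "(\<Sum>n. p n * s ^ n) = exp (- (\<Sum>n. b n / real n * s ^ n)) / (1 - s)"
      using s by (simp add: field_simps)
    \<comment> \<open>Writing \<open>1 - s\<close> as an exponential merges the two series. The
      logarithmic one diverges at \<open>s = 1\<close>, but the difference has nonnegative terms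
      bounded by the assumed summable ones.\<close>
    also have "\<dots> = exp (\<Sum>n. 1 / real n * s ^ n - b n / real n * s ^ n)"
      unfolding one_minus_eq_exp[OF less_imp_le[OF s(1)] s(2)] suminf_diff[OF smb(2,1), symmetric]
      by (simp add: exp_diff exp_minus divide_inverse)
    also have "\<dots> \<le> exp (\<Sum>n. (1 - b n) / real n)"
    proof -
      have "1 / real n * s ^ n - b n / real n * s ^ n \<le> (1 - b n) / real n" for n
      proof -
        have "(1 - b n) / real n * s ^ n \<le> (1 - b n) / real n"
          using b_le[of n] s by (intro mult_right_le_one_le power_le_one) auto
        then show ?thesis by (simp add: diff_divide_distrib algebra_simps)
      qed
      then show ?thesis unfolding exp_le_cancel_iff by (rule suminf_le[OF _ summable_diff[OF smb(2,1)] sm])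
    qed
    finally have "(\<Sum>n. p n * s ^ n) \<le> exp (\<Sum>n. (1 - b n) / real n)" .
    moreover have "(\<Sum>n<K. p n * s ^ n) \<le> (\<Sum>n. p n * s ^ n)"
      by (rule sum_le_suminf[OF smp]) (use s p_nonneg in auto)
    ultimately show ?thesis by simp
  qed
  have "((\<lambda>s. \<Sum>n<K. p n * s ^ n) \<longlongrightarrow> (\<Sum>n<K. p n * 1 ^ n)) (at_left (1::real))"
    by (intro tendsto_intros)
  moreover have "\<forall>\<^sub>F s in at_left 1. (\<Sum>n<K. p n * s ^ n) \<le> exp (\<Sum>n. (1 - b n) / real n)"
    using eventually_at_left_real[of 0 1] by (rule eventually_mono) (auto intro: le)
  ultimately have "(\<Sum>n<K. p n * 1 ^ n) \<le> exp (\<Sum>n. (1 - b n) / real n)"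
    by (intro tendsto_upperbound) auto
  then show ?thesis by simp
qed

end

section \<open>The normal distribution function and C\<close>

interpretation std_normal: real_distribution "density lborel std_normal_density"
proof -
  have "prob_space (density lborel std_normal_density)"
    by (rule prob_space_normal_density) simp
  then show "real_distribution (density lborel std_normal_density)"
    by (simp add: real_distribution_def real_distribution_axioms_def)
qed

lemma Phi_mono: "x \<le> y \<Longrightarrow> Phi x \<le> Phi y"
  unfolding Phi_def by (rule std_normal.cdf_nondecreasing)

lemma Phi_nonneg: "0 \<le> Phi x"
  unfolding Phi_def by (rule std_normal.cdf_nonneg)

text \<open>The density is positive everywhere. Hence intervals have positive mass, which makes
  \<open>Phi\<close> strictly increasing, and points have none, which makes it continuous.\<close>

lemma null_sets_std_normal_iff:
  "A \<in> null_sets (density lborel std_normal_density) \<longleftrightarrow> A \<in> null_sets lborel"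
proof -
  have "A \<in> null_sets (density lborel std_normal_density) \<longleftrightarrow>
      A \<in> sets lborel \<and> (AE x in lborel. x \<in> A \<longrightarrow> ennreal (std_normal_density x) = 0)"
    by (rule null_sets_density_iff) simp
  also have "\<dots> \<longleftrightarrow> A \<in> sets lborel \<and> (AE x in lborel. x \<notin> A)"
    using normal_density_pos[of 1 0] by (simp add: ennreal_eq_0_iff not_le[symmetric])
  also have "\<dots> \<longleftrightarrow> A \<in> null_sets lborel"
    using AE_iff_null_sets[of A lborel] by (auto simp: null_sets_def)
  finally show ?thesis .
qed

lemma Phi_strict_mono:
  assumes "x < y"
  shows "Phi x < Phi y"
proof -
  have "measure (density lborel std_normal_density) {x<..y} \<noteq> 0"
  proof
    assume "measure (density lborel std_normal_density) {x<..y} = 0"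
    then have "{x<..y} \<in> null_sets (density lborel std_normal_density)"
      by (simp add: null_sets_def std_normal.emeasure_eq_measure)
    then have "emeasure lborel {x<..y} = 0"
      unfolding null_sets_std_normal_iff by (simp add: null_sets_def)
    then show False using \<open>x < y\<close> by simp
  qed
  then have "0 < measure (density lborel std_normal_density) {x<..y}"
    using measure_nonneg[of "density lborel std_normal_density" "{x<..y}"] by linarith
  then show ?thesis
    using std_normal.cdf_diff_eq[OF \<open>x < y\<close>] unfolding Phi_def by simp
qed

lemma isCont_Phi: "isCont Phi x"
proof -
  have "{x} \<in> null_sets (density lborel std_normal_density)"
    unfolding null_sets_std_normal_iff by (simp add: null_sets_def)
  then have "isCont (cdf (density lborel std_normal_density)) x"
    unfolding std_normal.isCont_cdf by (simp add: null_sets_def measure_def)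
  then show ?thesis by (simp add: Phi_def[abs_def])
qed

text \<open>Markov's inequality for the sixth moment: a power above four is needed to make the second
  moment of the survival times finite.\<close>
lemma Phi_tail_le:
  assumes "0 < y"
  shows "Phi (- y) \<le> 15 / y ^ 6"
proof -
  let ?N = "density lborel std_normal_density"
  \<comment> \<open>The constant 15 = 5 * 3 * 1 is the sixth moment of the standard normal
    law.\<close>
  have hb: "has_bochner_integral lborel (\<lambda>x. std_normal_density x * x ^ 6) 15"
    using std_normal_moment_even[of 3] by (simp add: fact_numeral)
  have "has_bochner_integral ?N (\<lambda>x. x ^ 6) 15"
    by (rule has_bochner_integral_density) (use hb in \<open>auto simp: normal_density_nonneg\<close>)
  then have int: "integrable ?N (\<lambda>x. x ^ 6 / y ^ 6)" "(LINT x|?N. x ^ 6 / y ^ 6) = 15 / y ^ 6"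
    by (auto simp: has_bochner_integral_iff)
  have "Phi (- y) = (LINT x|?N. indicator {.. - y} x)"
    unfolding Phi_def cdf_def by simp
  also have "\<dots> \<le> (LINT x|?N. x ^ 6 / y ^ 6)"
  proof (rule integral_mono[OF _ int(1)])
    show "integrable ?N (indicator {.. - y} :: real \<Rightarrow> real)"
      by (rule integrable_real_indicator) (auto simp: std_normal.emeasure_eq_measure)
    show "indicator {.. - y} x \<le> x ^ 6 / y ^ 6" for x
    proof (cases "x \<le> - y")
      case True
      then have "y ^ 6 \<le> \<bar>x\<bar> ^ 6" using assms by (intro power_mono) auto
      then show ?thesis using True assms by (simp add: field_simps power_even_abs)
    qed (use assms in simp)
  qed
  finally show ?thesis using int(2) assms by simp
qed

lemma Phi_sqrt_tail_le:
  assumes "0 < n" "0 < x"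
  shows "Phi (- sqrt (real n) * x) \<le> 15 / (real n ^ 3 * x ^ 6)"
proof -
  have "Phi (- sqrt (real n) * x) \<le> 15 / (sqrt (real n) * x) ^ 6"
    using Phi_tail_le[of "sqrt (real n) * x"] assms by simp
  also have "sqrt (real n) ^ 6 = real n ^ 3" using power_mult[of "sqrt (real n)" 2 3] by simp
  then have "(sqrt (real n) * x) ^ 6 = real n ^ 3 * x ^ 6" by (simp only: power_mult_distrib)
  finally show ?thesis .
qed

text \<open>Uniformity in \<open>x \<ge> a\<close> is what the Weierstrass test in
  \<open>continuous_on_Cfun\<close> requires; the decay is weakened to an inverse square, a
  convenient convergent majorant.\<close>

lemma Cfun_term_le:
  assumes "0 < a" "a \<le> x"
  shows "Phi (- sqrt (real (Suc n)) * x) / real (Suc n) \<le> 15 / a ^ 6 * inverse (real (Suc n) ^ 2)"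
proof -
  let ?n = "real (Suc n)"
  have "Phi (- sqrt ?n * x) \<le> Phi (- sqrt ?n * a)" using assms by (intro Phi_mono) simp
  also have "\<dots> \<le> 15 / (?n ^ 3 * a ^ 6)" using assms by (intro Phi_sqrt_tail_le) auto
  also have "15 / (?n ^ 3 * a ^ 6) \<le> 15 / (?n * a ^ 6)"
    using assms self_le_power[of ?n 3] by (intro divide_left_mono mult_right_mono) auto
  finally have "Phi (- sqrt ?n * x) / ?n \<le> 15 / (?n * a ^ 6) / ?n"
    by (rule divide_right_mono) simp
  also have "\<dots> = 15 / a ^ 6 * inverse (?n ^ 2)" by (simp add: power2_eq_square divide_inverse)
  finally show ?thesis .
qed

lemma summable_inverse_Suc_square: "summable (\<lambda>n. inverse (real (Suc n) ^ 2))"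
  using inverse_power_summable[of 2, where 'a = real] summable_Suc_iff[of "\<lambda>n. inverse (real n ^ 2)"] by simp

lemma summable_Cfun:
  assumes "0 < x"
  shows "summable (\<lambda>n. Phi (- sqrt (real (Suc n)) * x) / real (Suc n))"
  by (rule summable_comparison_test'[OF summable_mult[OF summable_inverse_Suc_square], of 0 _ "15 / x ^ 6"])
     (use Cfun_term_le[OF assms order_refl] Phi_nonneg in simp)

lemma continuous_on_Cfun: "continuous_on {0<..} Cfun"
proof (rule continuous_at_imp_continuous_on, rule ballI)
  fix x :: real assume x: "x \<in> {0<..}"
  \<comment> \<open>The majorant blows up at 0, so convergence is only locally uniform; half of
    \<open>x\<close> keeps the neighbourhood away from 0.\<close>
  define a where "a = x / 2"
  have a: "0 < a" "a < x" using x by (auto simp: a_def)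
  have "uniform_limit {a<..} (\<lambda>N x. \<Sum>n<N. Phi (- sqrt (real (Suc n)) * x) / real (Suc n))
      (\<lambda>x. \<Sum>n. Phi (- sqrt (real (Suc n)) * x) / real (Suc n)) sequentially"
  proof (rule Weierstrass_m_test)
    show "norm (Phi (- sqrt (real (Suc n)) * y) / real (Suc n)) \<le> 15 / a ^ 6 * inverse (real (Suc n) ^ 2)"
      if "y \<in> {a<..}" for n y
      using Cfun_term_le[of a y n] a that Phi_nonneg by simp
    show "summable (\<lambda>n. 15 / a ^ 6 * inverse (real (Suc n) ^ 2))"
      by (intro summable_mult summable_inverse_Suc_square)
  qed
  moreover have "continuous_on {a<..} (\<lambda>x. \<Sum>n<N. Phi (- sqrt (real (Suc n)) * x) / real (Suc n))" for N
  proof (intro continuous_on_sum continuous_on_divide continuous_on_const)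
    fix n
    have Phi: "continuous_on UNIV Phi"
      by (simp add: continuous_at_imp_continuous_on isCont_Phi)
    have lin: "continuous_on {a<..} (\<lambda>x. - sqrt (real (Suc n)) * x)" by (intro continuous_intros)
    show "continuous_on {a<..} (\<lambda>x. Phi (- sqrt (real (Suc n)) * x))"
      by (rule continuous_on_compose2[OF Phi lin]) simp
  qed simp
  ultimately have "continuous_on {a<..} (\<lambda>x. \<Sum>n. Phi (- sqrt (real (Suc n)) * x) / real (Suc n))"
    by (intro uniform_limit_theorem[where F = sequentially]) auto
  then have "continuous_on {a<..} Cfun"
    unfolding Cfun_def[abs_def] by (intro continuous_intros)
  then show "isCont Cfun x"
    using a by (simp add: continuous_on_eq_continuous_at)
qed

lemma Cfun_strict_antimono:
  assumes "0 < x" "x < y"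
  shows "Cfun y < Cfun x"
proof -
  have le: "Phi (- sqrt (real (Suc n)) * y) / real (Suc n) < Phi (- sqrt (real (Suc n)) * x) / real (Suc n)" for n
    using assms by (intro divide_strict_right_mono Phi_strict_mono) auto
  have sm: "summable (\<lambda>n. Phi (- sqrt (real (Suc n)) * x) / real (Suc n) - Phi (- sqrt (real (Suc n)) * y) / real (Suc n))"
    using assms by (intro summable_diff summable_Cfun) auto
  have "0 < (\<Sum>n. Phi (- sqrt (real (Suc n)) * x) / real (Suc n) - Phi (- sqrt (real (Suc n)) * y) / real (Suc n))"
    using le by (intro suminf_pos sm) simp
  also have "\<dots> = (\<Sum>n. Phi (- sqrt (real (Suc n)) * x) / real (Suc n)) - (\<Sum>n. Phi (- sqrt (real (Suc n)) * y) / real (Suc n))"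
    using assms by (intro suminf_diff[symmetric] summable_Cfun) auto
  finally show ?thesis unfolding Cfun_def by simp
qed

lemma Cfun_ge_1:
  assumes "0 < x"
  shows "1 \<le> Cfun x"
  using suminf_nonneg[OF summable_Cfun[OF assms]] Phi_nonneg unfolding Cfun_def by simp

text \<open>At \<open>x = 1 / sqrt N\<close> the first \<open>N\<close> arguments of
  \<open>Phi\<close> are at least -1, so the exponent is at least \<open>Phi (-1)\<close> times a
  harmonic sum.\<close>

lemma Cfun_unbounded_near_0:
  assumes d: "0 < d"
  shows "\<exists>x>0. c < Cfun x \<and> x < d"
proof -
  have P: "0 < Phi (-1)" using Phi_strict_mono[of "-2" "-1"] Phi_nonneg[of "-2"] by simp
  have "filterlim (\<lambda>n. \<Sum>k<n. 1 / real (Suc k)) at_top sequentially"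
    using harm_at_top unfolding harm_def[abs_def] 
    by (simp add: sum.atLeast1_atMost_eq divide_inverse)
  then have "\<forall>\<^sub>F n in sequentially. c / Phi (-1) \<le> (\<Sum>k<n. 1 / real (Suc k))"
    by (simp add: filterlim_at_top)
  moreover have "\<forall>\<^sub>F n in sequentially. inverse (d ^ 2) < real n"
    using filterlim_real_sequentially by (simp add: filterlim_at_top_dense)
  ultimately have "\<forall>\<^sub>F n in sequentially. c / Phi (-1) \<le> (\<Sum>k<n. 1 / real (Suc k)) \<and> inverse (d ^ 2) < real n"
    by (rule eventually_conj)
  then obtain N where N: "c / Phi (-1) \<le> (\<Sum>k<N. 1 / real (Suc k))" "inverse (d ^ 2) < real N"
    by (auto simp: eventually_sequentially)
  have N0: "0 < real N" using N(2) less_trans[of 0 "inverse (d ^ 2)" "real N"] d by simp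
  define x where "x = 1 / sqrt (real N)"
  have x: "0 < x" unfolding x_def using N0 by simp
  have "c \<le> (\<Sum>k<N. Phi (-1) / real (Suc k))"
    using N(1) P by (simp add: field_simps sum_distrib_left sum_divide_distrib)
  also have "\<dots> \<le> (\<Sum>k<N. Phi (- sqrt (real (Suc k)) * x) / real (Suc k))"
  proof (rule sum_mono)
    fix k assume "k \<in> {..<N}"
    then have "sqrt (real (Suc k)) \<le> sqrt (real N)" by (subst real_sqrt_le_iff) simp
    then have "-1 \<le> - sqrt (real (Suc k)) * x" unfolding x_def using N0 by (simp add: field_simps)
    then show "Phi (-1) / real (Suc k) \<le> Phi (- sqrt (real (Suc k)) * x) / real (Suc k)"
      by (intro divide_right_mono Phi_mono) auto
  qed
  also have "\<dots> \<le> (\<Sum>k. Phi (- sqrt (real (Suc k)) * x) / real (Suc k))"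
    using Phi_nonneg by (intro sum_le_suminf summable_Cfun x) auto
  also have "\<dots> < Cfun x"
    unfolding Cfun_def using exp_ge_add_one_self[of "\<Sum>k. Phi (- sqrt (real (Suc k)) * x) / real (Suc k)"]
    by linarith
  finally have "c < Cfun x" .
  moreover have "x < d"
  proof -
    have "(1 / d) ^ 2 < sqrt (real N) ^ 2" using N(2) N0 by (simp add: power_divide divide_inverse power_inverse)
    then have "1 / d < sqrt (real N)" by (rule power_less_imp_less_base) simp
    then show ?thesis unfolding x_def using d N0 by (simp add: field_simps)
  qed
  ultimately show ?thesis using x by auto
qed

lemma Cfun_level_unique:
  assumes "0 < y" "Cfun y < c"
  shows "\<exists>!x. x \<in> {0<..<y} \<and> Cfun x = c"
proof -
  obtain a where a: "0 < a" "c < Cfun a" "a < y" using Cfun_unbounded_near_0[OF assms(1)] by blast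
  have "\<exists>x\<ge>a. x \<le> y \<and> Cfun x = c"
    by (rule IVT2') (use a assms in \<open>auto intro: continuous_on_subset[OF continuous_on_Cfun]\<close>)
  then obtain x where x: "a \<le> x" "x \<le> y" "Cfun x = c" by blast
  moreover have "x \<noteq> y" using x assms by auto
  moreover have "x' = x" if "0 < x'" "Cfun x' = c" for x'
    using Cfun_strict_antimono[of x x'] Cfun_strict_antimono[of x' x] that x a
    by (cases x x' rule: linorder_cases) auto
  ultimately show ?thesis using a by (intro ex1I[of _ x]) auto
qed

section \<open>Random walks with normal steps\<close>

lemma Phi_minus: "Phi (- x) = 1 - Phi x"
proof -
  let ?N = "density lborel std_normal_density"
  have D: "distributed ?N lborel (\<lambda>x. x) std_normal_density"
    unfolding distributed_def by (auto simp: distr_id2)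
  have "distributed ?N lborel (\<lambda>x. 0 + (-1) * x) (normal_density (0 + (-1) * 0) (\<bar>-1\<bar> * 1))"
    by (rule std_normal.normal_density_affine[OF D]) auto
  then have "distr ?N lborel (\<lambda>x. - x) = ?N" unfolding distributed_def by simp
  then have "Phi (- x) = measure (distr ?N lborel (\<lambda>x. - x)) {..- x}"
    by (simp add: Phi_def cdf_def)
  also have "\<dots> = measure ?N ((\<lambda>x. - x) -` {..- x} \<inter> space ?N)"
    by (rule measure_distr) auto
  also have "(\<lambda>x. - x) -` {..- x} \<inter> space ?N = {x..}" by auto
  also have "measure ?N {x..} = measure ?N ({x<..} \<union> {x})" by (rule arg_cong[where f = "measure ?N"]) auto
  also have "\<dots> = measure ?N {x<..}"
  proof -
    have "{x} \<in> null_sets ?N" unfolding null_sets_std_normal_iff by (simp add: null_sets_def)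
    then show ?thesis by (intro measure_Un_null_set) auto
  qed
  also have "\<dots> = measure ?N (space ?N - {..x})" by (rule arg_cong[where f = "measure ?N"]) auto
  also have "\<dots> = 1 - Phi x" by (subst std_normal.prob_compl) (auto simp: Phi_def cdf_def)
  finally show ?thesis .
qed

text \<open>Carries events from an abstract i.i.d. stream to the product space where the ladder
  identities live. \<open>L\<close> is the target space and \<open>N\<close> the common law; their
  measurable sets agree, so the two product spaces can be exchanged.\<close>

lemma (in prob_space) iid_sequence_distr:
  fixes X :: "nat \<Rightarrow> 'a \<Rightarrow> 'b"
  assumes indep: "indep_vars (\<lambda>_. L) X UNIV" and N: "\<And>n. distr M L (X n) = N"
  shows "distr M (\<Pi>\<^sub>M n\<in>UNIV. N) (\<lambda>\<omega> n. X n \<omega>) = (\<Pi>\<^sub>M n\<in>UNIV. N)"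
    and "(\<lambda>\<omega> n. X n \<omega>) \<in> measurable M (\<Pi>\<^sub>M n\<in>UNIV. N)"
proof -
  have rv: "random_variable L (X n)" for n using indep by (auto simp: indep_vars_def)
  have sets: "sets N = sets L" using N[of 0] by (metis sets_distr)
  have sets_eq: "sets (\<Pi>\<^sub>M n\<in>(UNIV::nat set). L) = sets (\<Pi>\<^sub>M n\<in>(UNIV::nat set). N)"
    by (rule sets_PiM_cong) (simp_all add: sets)
  have "distr M (\<Pi>\<^sub>M n\<in>UNIV. L) (\<lambda>\<omega>. \<lambda>n\<in>UNIV. X n \<omega>) = (\<Pi>\<^sub>M n\<in>UNIV. distr M L (X n))"
    using indep_vars_iff_distr_eq_PiM'[where I = UNIV and M' = "\<lambda>_. L" and X = X] indep rv by auto
  then show "distr M (\<Pi>\<^sub>M n\<in>UNIV. N) (\<lambda>\<omega> n. X n \<omega>) = (\<Pi>\<^sub>M n\<in>UNIV. N)"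
    by (subst distr_cong[OF refl sets_eq[symmetric] refl]) (simp add: restrict_UNIV N)
  show "(\<lambda>\<omega> n. X n \<omega>) \<in> measurable M (\<Pi>\<^sub>M n\<in>UNIV. N)"
    unfolding measurable_cong_sets[OF refl sets_eq, symmetric]
    by (rule measurable_PiM_single') (use rv measurable_space[OF rv] in \<open>auto simp: PiE_iff\<close>)
qed

text \<open>The steps are random variables on an arbitrary space, so that the results hold both for
  the coordinates of \<open>single_stream\<close> and for one row of
  \<open>obs_measure\<close>.\<close>

locale normal_walk = prob_space +
  fixes X :: "nat \<Rightarrow> 'a \<Rightarrow> real" and m s :: real
  assumes indep: "indep_vars (\<lambda>_. borel) X UNIV"
    and normal: "\<And>n. distributed M lborel (X n) (normal_density m s)"
    and s: "0 < s"
begin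

definition avg :: "nat \<Rightarrow> 'a \<Rightarrow> real" where "avg n \<omega> = (\<Sum>j<n. X j \<omega>) / real n"

lemma X_measurable [measurable]: "X n \<in> borel_measurable M"
  using indep by (auto simp: indep_vars_def)

lemma avg_measurable [measurable]: "avg n \<in> borel_measurable M"
  unfolding avg_def[abs_def] by measurable

lemma prob_avg_le:
  assumes "0 < n"
  shows "prob {\<omega> \<in> space M. avg n \<omega> \<le> l} = Phi (- sqrt (real n) * ((m - l) / s))"
proof -
  let ?\<sigma> = "sqrt (real n) * s"
  have \<sigma>: "0 < ?\<sigma>" using assms s by simp
  have "distributed M lborel (\<lambda>\<omega>. \<Sum>j\<in>{..<n}. X j \<omega>) (normal_density (\<Sum>j\<in>{..<n}. m) (sqrt (\<Sum>j\<in>{..<n}. s\<^sup>2)))"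
    using assms s indep normal by (intro sum_indep_normal indep_vars_subset[OF indep]) auto
  moreover have "sqrt (\<Sum>j\<in>{..<n}. s\<^sup>2) = ?\<sigma>" using s by (simp add: real_sqrt_mult)
  ultimately have "distributed M lborel (\<lambda>\<omega>. \<Sum>j<n. X j \<omega>) (normal_density (real n * m) ?\<sigma>)"
    by simp
  then have D: "distributed M lborel (\<lambda>\<omega>. ((\<Sum>j<n. X j \<omega>) - real n * m) / ?\<sigma>) std_normal_density"
    by (subst (asm) normal_standard_normal_convert[OF \<sigma>])
  then have rv: "(\<lambda>\<omega>. ((\<Sum>j<n. X j \<omega>) - real n * m) / ?\<sigma>) \<in> measurable M lborel"
    and "distr M lborel (\<lambda>\<omega>. ((\<Sum>j<n. X j \<omega>) - real n * m) / ?\<sigma>) = density lborel std_normal_density"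
    by (auto simp: distributed_def)
  then have "Phi (- sqrt (real n) * ((m - l) / s)) =
      measure (distr M lborel (\<lambda>\<omega>. ((\<Sum>j<n. X j \<omega>) - real n * m) / ?\<sigma>)) {..- sqrt (real n) * ((m - l) / s)}"
    by (simp add: Phi_def cdf_def)
  also have "\<dots> = prob ((\<lambda>\<omega>. ((\<Sum>j<n. X j \<omega>) - real n * m) / ?\<sigma>) -` {..- sqrt (real n) * ((m - l) / s)} \<inter> space M)"
    by (rule measure_distr[OF rv]) simp
  also have "(\<lambda>\<omega>. ((\<Sum>j<n. X j \<omega>) - real n * m) / ?\<sigma>) -` {..- sqrt (real n) * ((m - l) / s)} \<inter> space M
      = {\<omega> \<in> space M. avg n \<omega> \<le> l}"
  proof -
    have "- sqrt (real n) * ((m - l) / s) * ?\<sigma> = - (sqrt (real n) * sqrt (real n)) * (m - l)"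
      using s by simp
    then have *: "- sqrt (real n) * ((m - l) / s) * ?\<sigma> = real n * l - real n * m"
      by (simp add: algebra_simps)
    have "(x - real n * m) / ?\<sigma> \<le> - sqrt (real n) * ((m - l) / s) \<longleftrightarrow> x / real n \<le> l" for x
      unfolding pos_divide_le_eq[OF \<sigma>] * using assms by (simp add: pos_divide_le_eq mult.commute)
    then show ?thesis unfolding avg_def by (auto simp del: mult_minus_left)
  qed
  finally show ?thesis by simp
qed

lemma prob_avg_greater:
  assumes "0 < n"
  shows "prob {\<omega> \<in> space M. l < avg n \<omega>} = Phi (- sqrt (real n) * ((l - m) / s))"
proof -
  have "{\<omega> \<in> space M. l < avg n \<omega>} = space M - {\<omega> \<in> space M. avg n \<omega> \<le> l}" by auto
  then have "prob {\<omega> \<in> space M. l < avg n \<omega>} = 1 - prob {\<omega> \<in> space M. avg n \<omega> \<le> l}"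
    by (simp only: ) (rule prob_compl, measurable)
  also have "\<dots> = Phi (- (- sqrt (real n) * ((m - l) / s)))"
    unfolding prob_avg_le[OF assms] Phi_minus ..
  also have "- (- sqrt (real n) * ((m - l) / s)) = - sqrt (real n) * ((l - m) / s)"
    using s by (simp add: field_simps)
  finally show ?thesis .
qed

text \<open>The law of \<open>X n - l\<close>: after this shift an average above \<open>l\<close> is
  a positive partial sum.\<close>

definition step_law :: "real \<Rightarrow> real measure" where
  "step_law l = density lborel (normal_density (m - l) s)"

lemma iid_walk_step_law: "iid_walk (step_law l)"
proof -
  have "prob_space (step_law l)" unfolding step_law_def by (rule prob_space_normal_density[OF s])
  then show ?thesis
    unfolding iid_walk_def iid_walk_axioms_def sequence_space_def product_prob_space_def
      product_prob_space_axioms_def product_sigma_finite_def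
    by (auto simp: step_law_def prob_space_imp_sigma_finite)
qed

lemma prob_shifted_walk:
  assumes Q: "Measurable.pred (\<Pi>\<^sub>M n\<in>UNIV. step_law l) Q"
  shows "measure (\<Pi>\<^sub>M n\<in>UNIV. step_law l) {x \<in> space (\<Pi>\<^sub>M n\<in>UNIV. step_law l). Q x} =
    prob {\<omega> \<in> space M. Q (\<lambda>n. X n \<omega> - l)}"
proof -
  let ?S = "\<Pi>\<^sub>M n\<in>(UNIV::nat set). step_law l"
  have ind: "indep_vars (\<lambda>_. borel) (\<lambda>n \<omega>. X n \<omega> - l) UNIV"
    by (rule indep_vars_compose2[OF indep]) simp
  have d: "distr M borel (\<lambda>\<omega>. X n \<omega> - l) = step_law l" for n
  proof -
    have "distributed M lborel (\<lambda>\<omega>. - l + 1 * X n \<omega>) (normal_density (- l + 1 * m) (\<bar>1\<bar> * s))"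
      by (rule normal_density_affine[OF normal s]) simp
    then have "distr M lborel (\<lambda>\<omega>. - l + 1 * X n \<omega>) = step_law l"
      by (simp add: distributed_def step_law_def)
    moreover have "distr M lborel (\<lambda>\<omega>. - l + 1 * X n \<omega>) = distr M borel (\<lambda>\<omega>. X n \<omega> - l)"
      by (rule distr_cong) auto
    ultimately show ?thesis by simp
  qed
  have "measure ?S {x \<in> space ?S. Q x} = measure (distr M ?S (\<lambda>\<omega> n. X n \<omega> - l)) {x \<in> space ?S. Q x}"
    by (simp only: iid_sequence_distr(1)[OF ind d])
  also have "\<dots> = prob ((\<lambda>\<omega> n. X n \<omega> - l) -` {x \<in> space ?S. Q x} \<inter> space M)"
    by (rule measure_distr[OF iid_sequence_distr(2)[OF ind d]]) (use Q in measurable)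
  also have "(\<lambda>\<omega> n. X n \<omega> - l) -` {x \<in> space ?S. Q x} \<inter> space M = {\<omega> \<in> space M. Q (\<lambda>n. X n \<omega> - l)}"
    using measurable_space[OF iid_sequence_distr(2)[OF ind d]] by auto
  finally show ?thesis .
qed

lemma psum_shifted: "0 < n \<Longrightarrow> 0 < psum (\<lambda>j. X j \<omega> - l) n \<longleftrightarrow> l < avg n \<omega>"
  by (simp add: psum_def avg_def sum_subtractf field_simps)

lemma b_step_law:
  assumes "0 < n"
  shows "iid_walk.b (step_law l) n = Phi (- sqrt (real n) * ((m - l) / s))"
proof -
  interpret W: iid_walk "step_law l" by (rule iid_walk_step_law)
  have "W.b n = prob {\<omega> \<in> space M. psum (\<lambda>j. X j \<omega> - l) n \<le> 0}"
    unfolding W.b_def by (rule prob_shifted_walk) measurable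
  also have "\<dots> = prob {\<omega> \<in> space M. avg n \<omega> \<le> l}"
    using psum_shifted[OF assms] by (simp only: not_less[symmetric])
  finally show ?thesis using prob_avg_le[OF assms] by simp
qed

text \<open>The shifted steps have positive mean, so \<open>b n / n\<close> is summable, and its sum
  is the exponent in \<open>Cfun ((m - l) / s)\<close>.\<close>

lemma prob_avg_always_greater:
  assumes "l < m"
  shows "prob {\<omega> \<in> space M. \<forall>n\<ge>1. l < avg n \<omega>} = 1 / Cfun ((m - l) / s)"
proof -
  interpret W: iid_walk "step_law l" by (rule iid_walk_step_law)
  have pos: "0 < (m - l) / s" using assms s by simp
  have eq: "W.b (Suc n) / real (Suc n) = Phi (- sqrt (real (Suc n)) * ((m - l) / s)) / real (Suc n)" for n
    by (simp only: b_step_law zero_less_Suc)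
  have sm: "summable (\<lambda>n. W.b (Suc n) / real (Suc n))"
    unfolding eq by (rule summable_Cfun[OF pos])
  then have sm': "summable (\<lambda>n. W.b n / real n)" by (subst (asm) summable_Suc_iff)
  \<comment> \<open>The term at index 0 is a division by zero, hence 0, so the sum may start at 1 as
    in \<open>Cfun\<close>.\<close>
  have "(\<Sum>n. W.b n / real n) = (\<Sum>n. W.b (Suc n) / real (Suc n))"
    using suminf_split_head[OF sm'] by simp
  then have *: "1 / Cfun ((m - l) / s) = exp (- (\<Sum>n. W.b n / real n))"
    unfolding Cfun_def eq by (simp add: exp_minus inverse_eq_divide)
  have "prob {\<omega> \<in> space M. \<forall>n\<ge>1. l < avg n \<omega>} = prob {\<omega> \<in> space M. \<forall>n\<ge>1. 0 < psum (\<lambda>j. X j \<omega> - l) n}"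
    by (rule arg_cong[where f = prob]) (auto simp: psum_shifted)
  also have "\<dots> = measure W.S {x \<in> space W.S. \<forall>n\<ge>1. 0 < psum x n}"
    by (rule prob_shifted_walk[symmetric]) measurable
  also have "\<dots> = exp (- (\<Sum>n. W.b n / real n))"
    by (rule W.prob_never_descends[OF sm'])
  finally show ?thesis using * by simp
qed

text \<open>The shifted steps have negative mean, so now \<open>1 - b n\<close> is small; by
  \<open>Phi_minus\<close> it is the term of \<open>Cfun\<close> with the drift reversed.\<close>

lemma sum_prob_avg_greater_le:
  assumes "m < l"
  shows "(\<Sum>n<K. prob {\<omega> \<in> space M. \<forall>j\<in>{1..n}. l < avg j \<omega>}) \<le> Cfun ((l - m) / s)"
proof -
  interpret W: iid_walk "step_law l" by (rule iid_walk_step_law)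
  have pos: "0 < (l - m) / s" using assms s by simp
  have eq: "(1 - W.b (Suc n)) / real (Suc n) = Phi (- sqrt (real (Suc n)) * ((l - m) / s)) / real (Suc n)" for n
  proof -
    have "- (- sqrt (real (Suc n)) * ((m - l) / s)) = - sqrt (real (Suc n)) * ((l - m) / s)"
      using s by (simp add: field_simps)
    then show ?thesis by (simp only: b_step_law zero_less_Suc Phi_minus[symmetric])
  qed
  have sm: "summable (\<lambda>n. (1 - W.b (Suc n)) / real (Suc n))"
    unfolding eq by (rule summable_Cfun[OF pos])
  then have sm': "summable (\<lambda>n. (1 - W.b n) / real n)" by (subst (asm) summable_Suc_iff)
  have "(\<Sum>n. (1 - W.b n) / real n) = (\<Sum>n. (1 - W.b (Suc n)) / real (Suc n))"
    using suminf_split_head[OF sm'] by simp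
  then have *: "Cfun ((l - m) / s) = exp (\<Sum>n. (1 - W.b n) / real n)"
    unfolding Cfun_def eq by simp
  have "prob {\<omega> \<in> space M. \<forall>j\<in>{1..n}. l < avg j \<omega>} = W.p n" for n
  proof -
    have "prob {\<omega> \<in> space M. \<forall>j\<in>{1..n}. l < avg j \<omega>} = prob {\<omega> \<in> space M. \<forall>j\<in>{1..n}. 0 < psum (\<lambda>j. X j \<omega> - l) j}"
      by (rule arg_cong[where f = prob]) (auto simp: psum_shifted)
    then show ?thesis unfolding W.p_def by (subst prob_shifted_walk) auto
  qed
  then show ?thesis using W.sum_survival_le[OF sm', of K] * by simp
qed

text \<open>Survival through \<open>n\<close> forces the average at time \<open>n\<close> itself
  above \<open>l\<close>. The inverse cube stays summable after multiplication by \<open>n\<close>,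
  as the second moment requires.\<close>

lemma prob_survival_le:
  assumes "m < l" "0 < n"
  shows "prob {\<omega> \<in> space M. \<forall>j\<in>{1..n}. l < avg j \<omega>} \<le> 15 / (real n ^ 3 * ((l - m) / s) ^ 6)"
proof -
  have "prob {\<omega> \<in> space M. \<forall>j\<in>{1..n}. l < avg j \<omega>} \<le> prob {\<omega> \<in> space M. l < avg n \<omega>}"
    using assms by (intro finite_measure_mono) auto
  also have "\<dots> = Phi (- sqrt (real n) * ((l - m) / s))" by (rule prob_avg_greater[OF assms(2)])
  also have "\<dots> \<le> 15 / (real n ^ 3 * ((l - m) / s) ^ 6)"
    using assms s by (intro Phi_sqrt_tail_le) auto
  finally show ?thesis .
qed

end

section \<open>Sample paths of the greedy procedure\<close>

lemma best_idx_max: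
  assumes "1 \<le> k"
  shows "best_idx k \<omega> cnt \<in> {1..k}"
    and "j \<in> {1..k} \<Longrightarrow> xbar \<omega> j (cnt j) \<le> xbar \<omega> (best_idx k \<omega> cnt) (cnt (best_idx k \<omega> cnt))"
proof -
  have "Max ((\<lambda>i. xbar \<omega> i (cnt i)) ` {1..k}) \<in> (\<lambda>i. xbar \<omega> i (cnt i)) ` {1..k}"
    using assms by (intro Max_in) auto
  then obtain i where i: "i \<in> {1..k}" "xbar \<omega> i (cnt i) = Max ((\<lambda>i. xbar \<omega> i (cnt i)) ` {1..k})"
    by auto
  have "i \<in> {1..k} \<and> (\<forall>j\<in>{1..k}. xbar \<omega> j (cnt j) \<le> xbar \<omega> i (cnt i))"
    using i by simp
  from LeastI[of "\<lambda>i. i \<in> {1..k} \<and> (\<forall>j\<in>{1..k}. xbar \<omega> j (cnt j) \<le> xbar \<omega> i (cnt i))", OF this]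
  show "best_idx k \<omega> cnt \<in> {1..k}"
    and "j \<in> {1..k} \<Longrightarrow> xbar \<omega> j (cnt j) \<le> xbar \<omega> (best_idx k \<omega> cnt) (cnt (best_idx k \<omega> cnt))"
    unfolding best_idx_def by auto
qed

lemma best_idx_eq_1:
  assumes "1 \<le> k" "\<And>j. j \<in> {2..k} \<Longrightarrow> xbar \<omega> j (cnt j) \<le> xbar \<omega> 1 (cnt 1)"
  shows "best_idx k \<omega> cnt = 1"
proof -
  have "xbar \<omega> j (cnt j) \<le> xbar \<omega> 1 (cnt 1)" if "j \<in> {1..k}" for j
    using assms(2)[of j] that by (cases "j = 1") auto
  then have "best_idx k \<omega> cnt \<le> 1"
    unfolding best_idx_def using assms(1) by (intro Least_le) auto
  then show ?thesis using best_idx_max(1)[OF assms(1), of \<omega> cnt] by auto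
qed

lemma sum_greedy_counts:
  assumes "1 \<le> k"
  shows "(\<Sum>i\<in>{1..k}. greedy_counts k \<omega> t i) = k + t"
proof (induction t)
  case (Suc t)
  define c where "c = greedy_counts k \<omega> t"
  define b where "b = best_idx k \<omega> c"
  have b: "b \<in> {1..k}" unfolding b_def using best_idx_max(1)[OF assms] .
  have "(\<Sum>i\<in>{1..k}. greedy_counts k \<omega> (Suc t) i) = (\<Sum>i\<in>{1..k}. c i + (if i = b then 1 else 0))"
    by (intro sum.cong) (auto simp: c_def b_def Let_def)
  also have "\<dots> = k + Suc t" using Suc b by (simp add: sum.distrib c_def)
  finally show ?case .
qed simp

lemma greedy_counts_pos: "1 \<le> greedy_counts k \<omega> t i"
  by (induction t) (auto simp: Let_def le_SucI)

text \<open>Once the best alternative has been sampled beyond a minimiser \<open>s\<close> of its sample mean, all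
  others lie below that minimum and are never sampled again.\<close>
lemma greedy_counts_inv:
  assumes k: "1 \<le> k" and s: "1 \<le> s" and min: "\<And>n. 1 \<le> n \<Longrightarrow> xbar \<omega> 1 s \<le> xbar \<omega> 1 n"
  shows "(\<forall>i\<in>{2..k}. \<forall>j\<in>{1..<greedy_counts k \<omega> t i}. xbar \<omega> 1 s \<le> xbar \<omega> i j) \<and>
    (s < greedy_counts k \<omega> t 1 \<longrightarrow> (\<forall>i\<in>{2..k}. xbar \<omega> i (greedy_counts k \<omega> t i) \<le> xbar \<omega> 1 s))"
proof (induction t)
  case 0
  then show ?case using s by simp
next
  case (Suc t)
  define c where "c = greedy_counts k \<omega> t"
  define b where "b = best_idx k \<omega> c"
  have b: "b \<in> {1..k}" "\<And>j. j \<in> {1..k} \<Longrightarrow> xbar \<omega> j (c j) \<le> xbar \<omega> b (c b)"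
    unfolding b_def using best_idx_max[OF k] by auto
  have IH: "\<And>i j. i \<in> {2..k} \<Longrightarrow> j \<in> {1..<c i} \<Longrightarrow> xbar \<omega> 1 s \<le> xbar \<omega> i j"
      "\<And>i. s < c 1 \<Longrightarrow> i \<in> {2..k} \<Longrightarrow> xbar \<omega> i (c i) \<le> xbar \<omega> 1 s"
    using Suc unfolding c_def by auto
  have step: "greedy_counts k \<omega> (Suc t) = c(b := c b + 1)" by (simp add: c_def b_def Let_def)
  have c1: "1 \<le> c i" for i unfolding c_def by (rule greedy_counts_pos)
  \<comment> \<open>The sampled alternative has at least the current mean of alternative 1, which is
    at least its overall minimum.\<close>
  have bl: "xbar \<omega> 1 s \<le> xbar \<omega> b (c b)"
    using b(2)[of 1] min[OF c1[of 1]] k by auto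
  have "b = 1" if "s < c 1"
    unfolding b_def by (rule best_idx_eq_1[OF k]) (use IH(2) that min[OF c1[of 1]] in \<open>force\<close>)
  then have late: "xbar \<omega> i (c i) \<le> xbar \<omega> 1 s" "b = 1" if s1: "s < (c(b := c b + 1)) 1" and i: "i \<in> {2..k}" for i
  proof -
    \<comment> \<open>Either alternative 1 had passed \<open>s\<close> before, or it is sampled now
      at count \<open>s\<close>; in the second case it wins while showing its minimum, so all others
      are at or below that minimum.\<close>
    have or: "s < c 1 \<or> b = 1 \<and> c 1 = s" using s1 by (cases "b = 1") auto
    then show "b = 1" using \<open>s < c 1 \<Longrightarrow> b = 1\<close> by auto
    show "xbar \<omega> i (c i) \<le> xbar \<omega> 1 s"
      using or
    proof (elim disjE conjE)
      assume "b = 1" "c 1 = s"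
      then show ?thesis using b(2)[of i] i by simp
    qed (use IH(2) i in auto)
  qed
  show ?case unfolding step
  proof (intro conjI ballI impI)
    fix i j assume i: "i \<in> {2..k}" and j: "j \<in> {1..<(c(b := c b + 1)) i}"
    show "xbar \<omega> 1 s \<le> xbar \<omega> i j"
    proof (cases "i = b \<and> j = c b")
      case True
      then show ?thesis using bl by simp
    next
      case False
      then have "j \<in> {1..<c i}" using j by (auto split: if_splits)
      then show ?thesis using IH(1) i by blast
    qed
  next
    fix i assume "s < (c(b := c b + 1)) 1" "i \<in> {2..k}"
    then show "xbar \<omega> i ((c(b := c b + 1)) i) \<le> xbar \<omega> 1 s"
      using late[of i] by auto
  qed
qed

text \<open>The cardinality is the first time the mean of \<open>i\<close> is at or below
  \<open>l\<close>, capped at \<open>B\<close>; \<open>n = 0\<close> qualifies vacuously and pays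
  for the observation that brings the mean down. If alternative 1 never passed \<open>s\<close>, all
  counts together would fall short of \<open>B\<close>.\<close>

lemma greedy_select_eq_1:
  assumes k: "1 \<le> k" "k \<le> B" and s: "1 \<le> s" "s \<le> L"
    and min: "\<And>n. 1 \<le> n \<Longrightarrow> xbar \<omega> 1 s \<le> xbar \<omega> 1 n" and above: "l < xbar \<omega> 1 s"
    and budget: "L + (\<Sum>i\<in>{2..k}. card {n. n < B \<and> (\<forall>j\<in>{1..n}. l < xbar \<omega> i j)}) < B"
  shows "greedy_select k B \<omega> = 1"
proof -
  define c where "c = greedy_counts k \<omega> (B - k)"
  have inv: "\<And>i j. i \<in> {2..k} \<Longrightarrow> j \<in> {1..<c i} \<Longrightarrow> xbar \<omega> 1 s \<le> xbar \<omega> i j"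
      "\<And>i. s < c 1 \<Longrightarrow> i \<in> {2..k} \<Longrightarrow> xbar \<omega> i (c i) \<le> xbar \<omega> 1 s"
    using greedy_counts_inv[OF k(1) s(1) min, of "B - k"] unfolding c_def by auto
  have sum: "(\<Sum>i\<in>{1..k}. c i) = B" unfolding c_def using sum_greedy_counts[OF k(1)] k(2) by simp
  have "s < c 1"
  proof (rule ccontr)
    assume "\<not> s < c 1"
    have "c i \<le> card {n. n < B \<and> (\<forall>j\<in>{1..n}. l < xbar \<omega> i j)}" if i: "i \<in> {2..k}" for i
    proof -
      \<comment> \<open>The cap at \<open>B\<close> costs nothing, since no single count exceeds the
        total.\<close>
      have "c i \<le> B" using sum member_le_sum[of i "{1..k}" c] i by simp
      then have "{..<c i} \<subseteq> {n. n < B \<and> (\<forall>j\<in>{1..n}. l < xbar \<omega> i j)}"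
        using inv(1)[OF i] above by (force intro: less_le_trans)
      then have "card {..<c i} \<le> card {n. n < B \<and> (\<forall>j\<in>{1..n}. l < xbar \<omega> i j)}"
        by (intro card_mono) auto
      then show ?thesis by simp
    qed
    then have "(\<Sum>i\<in>{2..k}. c i) \<le> (\<Sum>i\<in>{2..k}. card {n. n < B \<and> (\<forall>j\<in>{1..n}. l < xbar \<omega> i j)})"
      by (rule sum_mono)
    moreover have "(\<Sum>i\<in>{1..k}. c i) = c 1 + (\<Sum>i\<in>{2..k}. c i)"
      using k(1) by (subst sum.atLeast_Suc_atMost) (auto simp: numeral_2_eq_2)
    ultimately show False using sum budget \<open>\<not> s < c 1\<close> s(2) by linarith
  qed
  show ?thesis unfolding greedy_select_def c_def[symmetric]
  proof (rule best_idx_eq_1[OF k(1)])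
    fix j assume "j \<in> {2..k}"
    then have "xbar \<omega> j (c j) \<le> xbar \<omega> 1 s" using inv(2) \<open>s < c 1\<close> by blast
    also have "\<dots> \<le> xbar \<omega> 1 (c 1)" using \<open>s < c 1\<close> by (intro min) simp
    finally show "xbar \<omega> j (c j) \<le> xbar \<omega> 1 (c 1)" .
  qed
qed

section \<open>Measurability of the selected index\<close>

lemma measurable_xbar [measurable]:
  assumes [measurable_cong]: "sets M = sets (\<Pi>\<^sub>M i\<in>UNIV. borel)"
  shows "(\<lambda>\<omega>. xbar \<omega> i n) \<in> borel_measurable M"
  unfolding xbar_def by measurable

text \<open>The sample sizes are themselves random; their countable range reduces
  \<open>xbar\<close> at a random size to fixed sizes.\<close>

lemma measurable_best_idx:
  assumes M: "sets M = sets (\<Pi>\<^sub>M i\<in>UNIV. borel)"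
    and c: "\<And>i. (\<lambda>\<omega>. c \<omega> i) \<in> measurable M (count_space UNIV)"
  shows "(\<lambda>\<omega>. best_idx k \<omega> (c \<omega>)) \<in> measurable M (count_space UNIV)"
proof -
  have [measurable]: "(\<lambda>\<omega>. xbar \<omega> i (c \<omega> i)) \<in> borel_measurable M" for i
    by (rule measurable_compose_countable[OF _ c]) (rule measurable_xbar[OF M])
  have [measurable]: "Measurable.pred M (\<lambda>\<omega>. xbar \<omega> j (c \<omega> j) \<le> xbar \<omega> i (c \<omega> i))" for i j
    unfolding pred_def by (rule borel_measurable_le) fact+
  show ?thesis unfolding best_idx_def
    by (rule measurable_Least) measurable
qed

lemma measurable_greedy_counts:
  assumes M: "sets M = sets (\<Pi>\<^sub>M i\<in>UNIV. borel)"
  shows "(\<lambda>\<omega>. greedy_counts k \<omega> t i) \<in> measurable M (count_space UNIV)"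
proof (induction t arbitrary: i)
  case (Suc t)
  note Suc[measurable]
  have [measurable]: "(\<lambda>\<omega>. best_idx k \<omega> (greedy_counts k \<omega> t)) \<in> measurable M (count_space UNIV)"
    by (rule measurable_best_idx[OF M Suc])
  have "greedy_counts k \<omega> (Suc t) i =
      (if i = best_idx k \<omega> (greedy_counts k \<omega> t) then greedy_counts k \<omega> t i + 1 else greedy_counts k \<omega> t i)" for \<omega>
    by (simp add: Let_def)
  then show ?case by (simp only:) measurable
qed simp

lemma measurable_greedy_select:
  assumes M: "sets M = sets (\<Pi>\<^sub>M i\<in>UNIV. borel)"
  shows "greedy_select k B \<in> measurable M (count_space UNIV)"
  unfolding greedy_select_def[abs_def]
  by (intro measurable_best_idx[OF M] measurable_greedy_counts[OF M])

section \<open>The budget consumed by inferior alternatives\<close>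

text \<open>The injection \<open>g\<close> selects the coordinates: a row
  \<open>\<lambda>n. (i, n)\<close> for one alternative, or the identity for all
  observations.\<close>

lemma PiM_coordinates_indep:
  fixes F :: "'i \<Rightarrow> 'b measure" and g :: "'j \<Rightarrow> 'i"
  assumes P: "\<And>i. prob_space (F i)" and sets: "\<And>i. sets (F i) = sets L" and g: "inj g"
  shows "prob_space.indep_vars (PiM UNIV F) (\<lambda>_. L) (\<lambda>n \<omega>. \<omega> (g n)) UNIV"
    and "distr (PiM UNIV F) L (\<lambda>\<omega>. \<omega> i) = F i"
proof -
  interpret prob_space "PiM UNIV F" by (rule prob_space_PiM) (rule P)
  have d: "distr (PiM UNIV F) L (\<lambda>\<omega>. \<omega> i) = F i" for i
    by (subst distr_cong[OF refl sets[of i, symmetric] refl]) (rule distr_PiM_component, auto simp: P)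
  then show "distr (PiM UNIV F) L (\<lambda>\<omega>. \<omega> i) = F i" .
  have rv: "(\<lambda>\<omega>. \<omega> i) \<in> measurable (PiM UNIV F) L" for i
    unfolding measurable_cong_sets[OF refl sets[of i, symmetric]] by simp
  have sets_eq: "sets (\<Pi>\<^sub>M n\<in>UNIV. L) = sets (\<Pi>\<^sub>M n\<in>UNIV. F (g n))"
    by (rule sets_PiM_cong) (simp_all add: sets)
  have "distr (PiM UNIV F) (\<Pi>\<^sub>M n\<in>UNIV. F (g n)) (\<lambda>\<omega>. \<lambda>n\<in>UNIV. \<omega> (g n)) = (\<Pi>\<^sub>M n\<in>UNIV. F (g n))"
    by (rule distr_PiM_reindex) (use P g in auto)
  then have "distr (PiM UNIV F) (\<Pi>\<^sub>M n\<in>UNIV. L) (\<lambda>\<omega>. \<lambda>n\<in>UNIV. \<omega> (g n)) = (\<Pi>\<^sub>M n\<in>UNIV. F (g n))"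
    by (subst distr_cong[OF refl sets_eq refl])
  then show "indep_vars (\<lambda>_. L) (\<lambda>n \<omega>. \<omega> (g n)) UNIV"
    by (subst indep_vars_iff_distr_eq_PiM') (auto simp: d rv)
qed

text \<open>A one-sided weak law for independent summands with different laws. \<open>K\<close>
  secures integrability and does not enter the estimate, so it may grow with the budget.\<close>

lemma (in prob_space) sum_tail_Chebyshev:
  fixes T :: "'i \<Rightarrow> 'a \<Rightarrow> real"
  assumes I: "finite I" and indep: "indep_vars (\<lambda>_. borel) T I"
    and bnd: "\<And>i \<omega>. i \<in> I \<Longrightarrow> \<bar>T i \<omega>\<bar> \<le> K"
    and mean: "\<And>i. i \<in> I \<Longrightarrow> expectation (T i) \<le> e"
    and second: "\<And>i. i \<in> I \<Longrightarrow> expectation (\<lambda>\<omega>. (T i \<omega>)\<^sup>2) \<le> V"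
    and a: "0 < a"
  shows "prob {\<omega> \<in> space M. real (card I) * e + a \<le> (\<Sum>i\<in>I. T i \<omega>)} \<le> real (card I) * V / a\<^sup>2"
proof -
  have rv [measurable]: "T i \<in> borel_measurable M" if "i \<in> I" for i
    using indep that by (auto simp: indep_vars_def)
  define D where "D i \<omega> = T i \<omega> - expectation (T i)" for i \<omega>
  have int: "integrable M (T i)" if "i \<in> I" for i
    by (rule integrable_const_bound[of _ K]) (use bnd[OF that] rv[OF that] in auto)
  have int2: "integrable M (\<lambda>\<omega>. (T i \<omega>)\<^sup>2)" if "i \<in> I" for i
  proof (rule integrable_const_bound[of _ "K\<^sup>2"])
    show "AE \<omega> in M. norm ((T i \<omega>)\<^sup>2) \<le> K\<^sup>2"
      using power_mono[OF bnd[OF that] abs_ge_zero, of _ 2] by simp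
  qed (use rv[OF that] in measurable)
  have rvD [measurable]: "D i \<in> borel_measurable M" if "i \<in> I" for i
    unfolding D_def[abs_def] using rv[OF that] by measurable
  have Dbnd: "\<bar>D i \<omega>\<bar> \<le> K + \<bar>expectation (T i)\<bar>" if "i \<in> I" for i \<omega>
    unfolding D_def using bnd[OF that, of \<omega>] by linarith
  have intD: "integrable M (D i)" if "i \<in> I" for i
    unfolding D_def[abs_def] using int[OF that] by simp
  have intDD: "integrable M (\<lambda>\<omega>. D i \<omega> * D j \<omega>)" if "i \<in> I" "j \<in> I" for i j
    by (rule integrable_const_bound[of _ "(K + \<bar>expectation (T i)\<bar>) * (K + \<bar>expectation (T j)\<bar>)"])
       (use Dbnd[OF that(1)] Dbnd[OF that(2)] that in \<open>auto simp: abs_mult intro!: mult_mono' order_trans[OF abs_ge_zero Dbnd[OF that(1)]]\<close>)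
  have ED: "expectation (D i) = 0" if "i \<in> I" for i
    unfolding D_def[abs_def] using int[OF that] by (simp add: prob_space)
  have EDD: "expectation (\<lambda>\<omega>. D i \<omega> * D j \<omega>) = (if i = j then variance (T i) else 0)" if "i \<in> I" "j \<in> I" for i j
  proof (cases "i = j")
    case False
    have "indep_vars (\<lambda>_. borel) D I"
      unfolding D_def[abs_def] by (rule indep_vars_compose2[OF indep]) simp
    then have "indep_vars (\<lambda>_. borel) D {i, j}" by (rule indep_vars_subset) (use that in auto)
    then have "expectation (\<lambda>\<omega>. \<Prod>k\<in>{i, j}. D k \<omega>) = (\<Prod>k\<in>{i, j}. expectation (D k))"
      by (intro indep_vars_lebesgue_integral) (use that intD in auto)
    then show ?thesis using False ED that by simp
  qed (simp add: D_def power2_eq_square)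
  define Z where "Z \<omega> = (\<Sum>i\<in>I. T i \<omega>)" for \<omega>
  have EZ: "expectation Z = (\<Sum>i\<in>I. expectation (T i))"
    unfolding Z_def[abs_def] by (rule Bochner_Integration.integral_sum) (rule int)
  have ZD: "Z \<omega> - expectation Z = (\<Sum>i\<in>I. D i \<omega>)" for \<omega>
    unfolding EZ Z_def D_def by (simp add: sum_subtractf)
  have "variance Z = expectation (\<lambda>\<omega>. \<Sum>i\<in>I. \<Sum>j\<in>I. D i \<omega> * D j \<omega>)"
    unfolding ZD power2_eq_square sum_product ..
  also have "\<dots> = (\<Sum>i\<in>I. \<Sum>j\<in>I. expectation (\<lambda>\<omega>. D i \<omega> * D j \<omega>))"
    using intDD by (subst Bochner_Integration.integral_sum; (intro Bochner_Integration.integrable_sum sum.cong refl Bochner_Integration.integral_sum)?) auto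
  also have "\<dots> = (\<Sum>i\<in>I. \<Sum>j\<in>I. if i = j then variance (T i) else 0)"
    by (intro sum.cong refl EDD)
  also have "\<dots> = (\<Sum>i\<in>I. variance (T i))"
    using I by simp
  also have "\<dots> \<le> (\<Sum>i\<in>I. V)"
  proof (rule sum_mono)
    fix i assume i: "i \<in> I"
    have "variance (T i) \<le> expectation (\<lambda>\<omega>. (T i \<omega>)\<^sup>2)"
      using variance_eq[OF int[OF i] int2[OF i]] by simp
    then show "variance (T i) \<le> V" using second[OF i] by linarith
  qed
  finally have var: "variance Z \<le> real (card I) * V" by simp
  have rvZ [measurable]: "Z \<in> borel_measurable M"
    unfolding Z_def[abs_def] using rv by (intro borel_measurable_sum)
  have intZ: "integrable M (\<lambda>\<omega>. (Z \<omega>)\<^sup>2)"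
  proof (rule integrable_const_bound[of _ "(\<Sum>i\<in>I. K)\<^sup>2"])
    have "\<bar>Z \<omega>\<bar> \<le> (\<Sum>i\<in>I. K)" for \<omega>
      unfolding Z_def by (rule order_trans[OF sum_abs]) (rule sum_mono, rule bnd)
    then have "\<bar>Z \<omega>\<bar> \<le> \<bar>\<Sum>i\<in>I. K\<bar>" for \<omega> by (rule order_trans) simp
    then show "AE \<omega> in M. norm ((Z \<omega>)\<^sup>2) \<le> (\<Sum>i\<in>I. K)\<^sup>2"
      by (simp only: real_norm_def abs_power2 abs_le_square_iff[symmetric]) simp
  qed measurable
  have "prob {\<omega> \<in> space M. real (card I) * e + a \<le> Z \<omega>} \<le> prob {\<omega> \<in> space M. a \<le> \<bar>Z \<omega> - expectation Z\<bar>}"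
  proof (rule finite_measure_mono)
    have "expectation Z \<le> (\<Sum>i\<in>I. e)" unfolding EZ by (rule sum_mono) (rule mean)
    then have "expectation Z \<le> real (card I) * e" by simp
    then show "{\<omega> \<in> space M. real (card I) * e + a \<le> Z \<omega>} \<subseteq> {\<omega> \<in> space M. a \<le> \<bar>Z \<omega> - expectation Z\<bar>}"
      by auto
  qed measurable
  also have "\<dots> \<le> variance Z / a\<^sup>2"
    by (rule Chebyshev_inequality[OF rvZ intZ a])
  also have "\<dots> \<le> real (card I) * V / a\<^sup>2" using var by (rule divide_right_mono) simp
  finally show ?thesis unfolding Z_def .
qed

section \<open>Survival times as sums of tail indicators\<close>

lemma card_downward_closed:
  assumes "\<And>n m. A n \<Longrightarrow> m \<le> n \<Longrightarrow> A m"
  shows "{n. n < K \<and> A n} = {..<card {n. n < K \<and> A (n::nat)}}"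
proof -
  let ?S = "{n. n < K \<and> A n}"
  define N where "N = (LEAST n. n \<notin> ?S)"
  have "K \<notin> ?S" by simp
  then have N: "N \<notin> ?S" unfolding N_def by (rule LeastI)
  have "n \<in> ?S" if "n < N" for n using not_less_Least[of n "\<lambda>n. n \<notin> ?S"] that unfolding N_def by blast
  moreover have "n < N" if "n \<in> ?S" for n
    using N assms[of n N] that by (metis (no_types, lifting) le_less_trans mem_Collect_eq not_less)
  ultimately have "?S = {..<N}" by blast
  then show ?thesis by simp
qed

lemma card_eq_sum_of_bool:
  fixes A :: "nat \<Rightarrow> bool"
  shows "real (card {n. n < K \<and> A n}) = (\<Sum>n<K. of_bool (A n))"
proof -
  have "{..<K} \<inter> {n. A n} = {n. n < K \<and> A n}" by auto
  then show ?thesis by simp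
qed

text \<open>The first N odd numbers sum to N squared, so a second moment becomes a weighted sum of
  tail probabilities.\<close>

lemma card_square_eq_sum:
  fixes A :: "nat \<Rightarrow> bool"
  assumes "\<And>n m. A n \<Longrightarrow> m \<le> n \<Longrightarrow> A m"
  shows "(real (card {n. n < K \<and> A n}))\<^sup>2 = (\<Sum>n<K. (2 * real n + 1) * of_bool (A n))"
proof -
  let ?c = "card {n. n < K \<and> A n}"
  have "(\<Sum>n<K. (2 * real n + 1) * of_bool (A n)) = (\<Sum>n\<in>{n. n < K \<and> A n}. 2 * real n + 1)"
    by (rule sum.mono_neutral_cong_right) auto
  also have "\<dots> = (\<Sum>n<?c. 2 * real n + 1)"
    by (rule sum.cong[OF card_downward_closed[of A K, OF assms] refl])
  also have "(\<Sum>n<N. 2 * real n + 1) = (real N)\<^sup>2" for N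
    by (induction N) (auto simp: power2_eq_square algebra_simps)
  finally show ?thesis by simp
qed

section \<open>Minima and survival times of normal sample means\<close>

context normal_walk
begin

lemma prob_eq_single_stream:
  assumes "Measurable.pred (single_stream m s) Q"
  shows "measure (single_stream m s) {x \<in> space (single_stream m s). Q x} = prob {\<omega> \<in> space M. Q (\<lambda>n. X n \<omega>)}"
  using prob_shifted_walk[where l = 0 and Q = Q] assms by (simp add: single_stream_def step_law_def)

text \<open>Borel-Cantelli with the polynomial tail bound gives the half of the strong law needed
  for the minimum to be attained.\<close>

lemma AE_eventually_avg_greater:
  assumes "l < m"
  shows "AE \<omega> in M. \<forall>\<^sub>F n in sequentially. l < avg n \<omega>"
proof -
  define A where "A n = {\<omega> \<in> space M. avg n \<omega> \<le> l}" for n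
  have "summable (\<lambda>n. prob (A n))"
  proof (rule summable_comparison_test'[of "\<lambda>n. 15 / ((m - l) / s) ^ 6 * inverse (real n ^ 2)" 1])
    show "summable (\<lambda>n. 15 / ((m - l) / s) ^ 6 * inverse (real n ^ 2))"
      using inverse_power_summable[of 2, where 'a = real] by (intro summable_mult) simp
    show "norm (prob (A n)) \<le> 15 / ((m - l) / s) ^ 6 * inverse (real n ^ 2)" if n: "1 \<le> n" for n
    proof -
      have "Phi (- sqrt (real n) * ((m - l) / s)) \<le> 15 / (real n ^ 3 * ((m - l) / s) ^ 6)"
        using assms n s by (intro Phi_sqrt_tail_le) auto
      also have "15 / (real n ^ 3 * ((m - l) / s) ^ 6) \<le> 15 / (real n ^ 2 * ((m - l) / s) ^ 6)"
        using assms n s by (intro divide_left_mono mult_right_mono power_increasing) auto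
      also have "\<dots> = 15 / ((m - l) / s) ^ 6 * inverse (real n ^ 2)" by (simp add: divide_inverse)
      finally show ?thesis using prob_avg_le[of n l] n Phi_nonneg by (simp add: A_def)
    qed
  qed
  then have "AE \<omega> in M. \<forall>\<^sub>F n in sequentially. \<omega> \<in> space M - A n"
    by (intro borel_cantelli_AE1) (auto simp: A_def emeasure_eq_measure)
  then show ?thesis
    by eventually_elim (auto simp: A_def elim!: eventually_mono)
qed

text \<open>Averages that never fell below \<open>m\<close> would stay above every
  \<open>m - s * x\<close>; that event has probability \<open>1 / Cfun x\<close>, arbitrarily small
  as \<open>x\<close> decreases to 0.\<close>

lemma AE_ex_avg_less: "AE \<omega> in M. \<exists>n\<ge>1. avg n \<omega> < m"
proof -
  let ?A = "{\<omega> \<in> space M. \<forall>n\<ge>1. m \<le> avg n \<omega>}"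
  have "prob ?A \<le> e" if e: "0 < e" for e
  proof -
    obtain x where x: "0 < x" "1 / e < Cfun x" using Cfun_unbounded_near_0[of 1 "1 / e"] by auto
    have l: "m - s * x < m" using x s by simp
    have "prob ?A \<le> prob {\<omega> \<in> space M. \<forall>n\<ge>1. m - s * x < avg n \<omega>}"
      using l by (intro finite_measure_mono) (auto intro: less_le_trans)
    also have "\<dots> = 1 / Cfun x" using prob_avg_always_greater[OF l] s by simp
    also have "\<dots> \<le> e" using x e Cfun_ge_1[OF x(1)] by (simp add: field_simps)
    finally show ?thesis .
  qed
  then have "prob ?A \<le> 0" by (rule field_le_epsilon[where y = 0, simplified])
  then have "prob ?A = 0" by (simp add: measure_le_0_iff)
  moreover have "?A \<in> events" by measurable
  ultimately have "AE \<omega> in M. \<omega> \<notin> ?A" by (subst (asm) prob_eq_0) auto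
  then show ?thesis by (rule AE_mp) (auto simp: not_le)
qed

text \<open>Some average lies below \<open>m\<close>, and all but finitely many exceed a level
  strictly between it and \<open>m\<close>; only finitely many times compete for the
  minimum.\<close>

lemma AE_min_attained: "AE \<omega> in M. \<exists>r\<ge>1. \<forall>n\<ge>1. avg r \<omega> \<le> avg n \<omega>"
proof -
  \<comment> \<open>The level needed depends on the path, so a countable family tending to
    \<open>m\<close> is treated at once.\<close>
  have "AE \<omega> in M. \<forall>j. \<forall>\<^sub>F n in sequentially. m - inverse (real (Suc j)) < avg n \<omega>"
    unfolding AE_all_countable by (intro allI AE_eventually_avg_greater) simp
  with AE_ex_avg_less show ?thesis
  proof eventually_elim
    fix \<omega> assume "\<exists>n\<ge>1. avg n \<omega> < m"
      and ev: "\<forall>j. \<forall>\<^sub>F n in sequentially. m - inverse (real (Suc j)) < avg n \<omega>"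
    then obtain n0 where n0: "1 \<le> n0" "avg n0 \<omega> < m" by blast
    obtain j where j: "inverse (real (Suc j)) < m - avg n0 \<omega>"
      using reals_Archimedean[of "m - avg n0 \<omega>"] n0 by auto
    obtain N where N: "\<And>n. N \<le> n \<Longrightarrow> m - inverse (real (Suc j)) < avg n \<omega>"
      using ev by (auto simp: eventually_sequentially)
    let ?I = "{1..max N n0}"
    have "Min ((\<lambda>n. avg n \<omega>) ` ?I) \<in> (\<lambda>n. avg n \<omega>) ` ?I"
      using n0 by (intro Min_in) auto
    then obtain r where r: "r \<in> ?I" "avg r \<omega> = Min ((\<lambda>n. avg n \<omega>) ` ?I)" by auto
    have le: "avg r \<omega> \<le> avg n \<omega>" if "n \<in> ?I" for n unfolding r(2) using that by (intro Min_le) auto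
    have "avg r \<omega> \<le> avg n \<omega>" if "1 \<le> n" for n
    proof (cases "n \<in> ?I")
      case False
      then have "m - inverse (real (Suc j)) < avg n \<omega>" using that by (intro N) auto
      then show ?thesis using le[of n0] j n0 by auto
    qed (rule le)
    then show "\<exists>r\<ge>1. \<forall>n\<ge>1. avg r \<omega> \<le> avg n \<omega>" using r(1) by auto
  qed
qed

text \<open>Continuity from below in \<open>L\<close>: since the minimum is almost surely attained,
  the union over \<open>L\<close> is almost surely the event that all averages exceed
  \<open>l\<close>.\<close>

lemma prob_early_min_tendsto:
  assumes "l < m"
  shows "(\<lambda>L. prob {\<omega> \<in> space M. \<exists>r\<in>{1..L}. l < avg r \<omega> \<and> (\<forall>n\<ge>1. avg r \<omega> \<le> avg n \<omega>)})
    \<longlonglongrightarrow> 1 / Cfun ((m - l) / s)"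
proof -
  let ?A = "\<lambda>L. {\<omega> \<in> space M. \<exists>r\<in>{1..L}. l < avg r \<omega> \<and> (\<forall>n\<ge>1. avg r \<omega> \<le> avg n \<omega>)}"
  have le [measurable]: "Measurable.pred M (\<lambda>\<omega>. avg r \<omega> \<le> avg n \<omega>)" for r n
    unfolding pred_def by (rule borel_measurable_le) measurable
  have meas [measurable]: "?A L \<in> events" for L by measurable
  have "(\<lambda>L. prob (?A L)) \<longlonglongrightarrow> prob (\<Union>L. ?A L)"
  proof (rule finite_Lim_measure_incseq)
    show "incseq ?A" by (auto simp: incseq_def)
  qed (use meas in auto)
  also have "prob (\<Union>L. ?A L) = prob {\<omega> \<in> space M. \<forall>n\<ge>1. l < avg n \<omega>}"
  proof (rule finite_measure_eq_AE)
    show "AE \<omega> in M. \<omega> \<in> (\<Union>L. ?A L) \<longleftrightarrow> \<omega> \<in> {\<omega> \<in> space M. \<forall>n\<ge>1. l < avg n \<omega>}"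
      using AE_min_attained
    proof eventually_elim
      fix \<omega> assume "\<exists>r\<ge>1. \<forall>n\<ge>1. avg r \<omega> \<le> avg n \<omega>"
      then obtain r where r: "1 \<le> r" "\<forall>n\<ge>1. avg r \<omega> \<le> avg n \<omega>" by blast
      then have "\<omega> \<in> ?A r" if "\<omega> \<in> space M" "\<forall>n\<ge>1. l < avg n \<omega>"
        using that by (auto intro!: bexI[of _ r])
      then show "\<omega> \<in> (\<Union>L. ?A L) \<longleftrightarrow> \<omega> \<in> {\<omega> \<in> space M. \<forall>n\<ge>1. l < avg n \<omega>}"
        by (blast intro: less_le_trans)
    qed
  qed measurable
  finally show ?thesis using prob_avg_always_greater[OF assms] by simp
qed

lemma expectation_survival_time_le:
  assumes "m < l"
  shows "expectation (\<lambda>\<omega>. real (card {n. n < K \<and> (\<forall>j\<in>{1..n}. l < avg j \<omega>)})) \<le> Cfun ((l - m) / s)"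
proof -
  have meas: "Measurable.pred M (\<lambda>\<omega>. \<forall>j\<in>{1..n}. l < avg j \<omega>)" for n by measurable
  have "expectation (\<lambda>\<omega>. real (card {n. n < K \<and> (\<forall>j\<in>{1..n}. l < avg j \<omega>)})) =
      (\<Sum>n<K. expectation (\<lambda>\<omega>. of_bool (\<forall>j\<in>{1..n}. l < avg j \<omega>)))"
    unfolding card_eq_sum_of_bool
    by (rule Bochner_Integration.integral_sum) (rule expectation_of_bool(2)[OF meas])
  then show ?thesis
    using sum_prob_avg_greater_le[OF assms, of K] by (simp only: expectation_of_bool(1)[OF meas])
qed

text \<open>The bound must not depend on \<open>K\<close>, because the cap will be the budget, which
  grows with the number of alternatives.\<close>

lemma expectation_survival_time_square_le:
  assumes l: "m < l"
  shows "expectation (\<lambda>\<omega>. (real (card {n. n < K \<and> (\<forall>j\<in>{1..n}. l < avg j \<omega>)}))\<^sup>2)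
    \<le> 1 + 45 / ((l - m) / s) ^ 6 * (\<Sum>n. inverse (real n ^ 2))"
proof -
  let ?x = "(l - m) / s"
  let ?p = "\<lambda>n. prob {\<omega> \<in> space M. \<forall>j\<in>{1..n}. l < avg j \<omega>}"
  have x: "0 < ?x" using l s by simp
  have meas: "Measurable.pred M (\<lambda>\<omega>. \<forall>j\<in>{1..n}. l < avg j \<omega>)" for n by measurable
  have "expectation (\<lambda>\<omega>. (real (card {n. n < K \<and> (\<forall>j\<in>{1..n}. l < avg j \<omega>)}))\<^sup>2) =
      expectation (\<lambda>\<omega>. \<Sum>n<K. (2 * real n + 1) * of_bool (\<forall>j\<in>{1..n}. l < avg j \<omega>))"
    by (subst card_square_eq_sum) auto
  also have "\<dots> = (\<Sum>n<K. expectation (\<lambda>\<omega>. (2 * real n + 1) * of_bool (\<forall>j\<in>{1..n}. l < avg j \<omega>)))"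
    by (rule Bochner_Integration.integral_sum) (rule integrable_mult_right, rule expectation_of_bool(2)[OF meas])
  also have "\<dots> = (\<Sum>n<K. (2 * real n + 1) * ?p n)"
    by (simp only: integral_mult_right_zero expectation_of_bool(1)[OF meas])
  \<comment> \<open>The term \<open>n = 0\<close> contributes 1, as \<open>inverse 0 = 0\<close>
    covers nothing there. For \<open>n \<ge> 1\<close>, \<open>2 * n + 1 \<le> 3 * n\<close> and the
    tail constant 15 give 45.\<close>
  also have "\<dots> \<le> (\<Sum>n<K. of_bool (n = 0) + 45 / ?x ^ 6 * inverse (real n ^ 2))"
  proof (rule sum_mono)
    fix n
    show "(2 * real n + 1) * ?p n \<le> of_bool (n = 0) + 45 / ?x ^ 6 * inverse (real n ^ 2)"
    proof (cases "n = 0")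
      case True then show ?thesis by simp
    next
      case False
      then have n: "1 \<le> real n" by simp
      have "(2 * real n + 1) * ?p n \<le> (3 * real n) * (15 / (real n ^ 3 * ?x ^ 6))"
        using prob_survival_le[OF l, of n] n False by (intro mult_mono) auto
      also have "\<dots> = 45 / ?x ^ 6 * inverse (real n ^ 2)"
        using n by (simp add: divide_inverse power3_eq_cube power2_eq_square)
      finally show ?thesis using False by simp
    qed
  qed
  also have "\<dots> \<le> 1 + 45 / ?x ^ 6 * (\<Sum>n<K. inverse (real n ^ 2))"
  proof -
    have "(\<Sum>n<K. of_bool (n = 0) :: real) \<le> 1" by (cases K) (auto simp: lessThan_Suc_eq_insert_0)
    then show ?thesis by (simp only: sum.distrib sum_distrib_left[symmetric] add_right_mono)
  qed
  also have "\<dots> \<le> 1 + 45 / ?x ^ 6 * (\<Sum>n. inverse (real n ^ 2))"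
    using x inverse_power_summable[of 2, where 'a = real]
    by (intro add_left_mono mult_left_mono sum_le_suminf) auto
  finally show ?thesis .
qed

end

section \<open>The joint law of all observations\<close>

lemma normal_walk_PiM:
  fixes F :: "'i \<Rightarrow> real measure" and g :: "nat \<Rightarrow> 'i"
  assumes P: "\<And>i. prob_space (F i)" and sets: "\<And>i. sets (F i) = sets borel" and g: "inj g"
    and F: "\<And>n. F (g n) = density lborel (normal_density m s)" and s: "0 < s"
  shows "normal_walk (PiM UNIV F) (\<lambda>n \<omega>. \<omega> (g n)) m s"
proof -
  interpret prob_space "PiM UNIV F" by (rule prob_space_PiM) (rule P)
  have ind: "indep_vars (\<lambda>_. borel) (\<lambda>n \<omega>. \<omega> (g n)) UNIV"
    by (rule PiM_coordinates_indep(1)[OF P sets g])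
  have "distr (PiM UNIV F) lborel (\<lambda>\<omega>. \<omega> (g n)) = density lborel (normal_density m s)" for n
    using PiM_coordinates_indep(2)[OF P sets g] F
    by (subst distr_cong[OF refl sets_lborel refl]) simp
  then show ?thesis
    using ind s by unfold_locales (auto simp: distributed_def indep_vars_def)
qed

lemma normal_walk_single_stream:
  assumes "0 < s"
  shows "normal_walk (single_stream m s) (\<lambda>n \<omega>. \<omega> n) m s"
  unfolding single_stream_def
  by (rule normal_walk_PiM[where g = "\<lambda>n. n"]) (use assms prob_space_normal_density in auto)

locale observations =
  fixes k :: nat and mu sg :: "nat \<Rightarrow> real"
  assumes sg_pos: "\<And>i. i \<in> {1..k} \<Longrightarrow> 0 < sg i"
begin

definition law :: "nat \<times> nat \<Rightarrow> real measure" where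
  "law = (\<lambda>(i, n). if i \<in> {1..k} then density lborel (normal_density (mu i) (sg i)) else return borel 0)"

lemma obs_measure_eq: "obs_measure k mu sg = PiM UNIV law"
  by (simp add: obs_measure_def law_def)

lemma prob_space_law: "prob_space (law p)"
  by (cases p) (auto simp: law_def intro!: prob_space_normal_density prob_space_return sg_pos)

lemma sets_law: "sets (law p) = sets borel"
  by (cases p) (auto simp: law_def)

sublocale prob_space "obs_measure k mu sg"
  unfolding obs_measure_eq by (rule prob_space_PiM) (rule prob_space_law)

lemma sets_obs: "sets (obs_measure k mu sg) = sets (\<Pi>\<^sub>M p\<in>UNIV. borel)"
  unfolding obs_measure_eq by (rule sets_PiM_cong) (auto simp: sets_law)

lemma normal_walk_stream:
  assumes "i \<in> {1..k}"
  shows "normal_walk (obs_measure k mu sg) (\<lambda>n \<omega>. \<omega> (i, n)) (mu i) (sg i)"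
  unfolding obs_measure_eq
  by (rule normal_walk_PiM[OF prob_space_law sets_law])
     (use assms sg_pos in \<open>auto simp: law_def inj_on_def\<close>)

lemma avg_eq_xbar:
  assumes "i \<in> {1..k}"
  shows "normal_walk.avg (\<lambda>n \<omega>. \<omega> (i, n)) n \<omega> = xbar \<omega> i n"
  by (simp add: normal_walk.avg_def[OF normal_walk_stream[OF assms]] xbar_def)

definition survival :: "real \<Rightarrow> nat \<Rightarrow> nat \<Rightarrow> (nat \<times> nat \<Rightarrow> real) \<Rightarrow> real" where
  "survival l K i \<omega> = real (card {n. n < K \<and> (\<forall>j\<in>{1..n}. l < xbar \<omega> i j)})"

lemma survival_bound: "\<bar>survival l K i \<omega>\<bar> \<le> real K"
  unfolding survival_def using card_mono[of "{..<K}" "{n. n < K \<and> (\<forall>j\<in>{1..n}. l < xbar \<omega> i j)}"] by auto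

text \<open>Each survival time reads row \<open>i\<close> alone, and the rows \<open>C i\<close> are
  disjoint blocks of independent coordinates.\<close>

lemma indep_survival: "indep_vars (\<lambda>_. borel) (survival l K) I"
proof -
  define C where "C i = {i} \<times> (UNIV :: nat set)" for i :: nat
  have ind: "indep_vars (\<lambda>_. borel) (\<lambda>p \<omega>. \<omega> p) UNIV"
    unfolding obs_measure_eq by (rule PiM_coordinates_indep(1)[OF prob_space_law sets_law]) simp
  have "indep_vars (\<lambda>i. PiM (C i) (\<lambda>_. borel)) (\<lambda>i \<omega>. restrict (\<lambda>p. \<omega> p) (C i)) I"
    by (rule indep_vars_restrict[OF ind]) (auto simp: C_def disjoint_family_on_def)
  then have "indep_vars (\<lambda>_. borel) (\<lambda>i \<omega>. survival l K i (restrict (\<lambda>p. \<omega> p) (C i))) I"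
  proof (rule indep_vars_compose2)
    fix i
    have [measurable]: "(\<lambda>\<omega>. xbar \<omega> i j) \<in> borel_measurable (PiM (C i) (\<lambda>_. borel))" for j
      unfolding xbar_def by (intro borel_measurable_divide borel_measurable_sum measurable_component_singleton) (auto simp: C_def)
    show "survival l K i \<in> borel_measurable (PiM (C i) (\<lambda>_. borel))"
      unfolding survival_def[abs_def] card_eq_sum_of_bool by measurable
  qed
  moreover have "survival l K i (restrict (\<lambda>p. \<omega> p) (C i)) = survival l K i \<omega>" for i \<omega>
    by (simp add: survival_def xbar_def C_def)
  ultimately show ?thesis by simp
qed

text \<open>\<open>a\<close> is the budget left after setting aside \<open>L\<close> for alternative
  1 and the mean bound \<open>Cfun x\<close> for each other alternative; it is the deviation allowed
  in Chebyshev's inequality. The event on alternative 1 is placed on \<open>single_stream\<close>,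
  whose law is free of \<open>k\<close>.\<close>

lemma PCS_lower_bound:
  assumes k: "1 \<le> k" "k \<le> B" and gap: "\<And>i. i \<in> {2..k} \<Longrightarrow> g \<le> mu 1 - mu i"
    and sb: "\<And>i. i \<in> {2..k} \<Longrightarrow> sg i \<le> sb" "0 < sb"
    and l: "mu 1 - g < l" "l < mu 1"
    and x: "x = (l - (mu 1 - g)) / sb"
    and a: "a = real B - real L - real (k - 1) * Cfun x" "0 < a"
  shows "measure (single_stream (mu 1) (sg 1)) {\<omega> \<in> space (single_stream (mu 1) (sg 1)).
        \<exists>r\<in>{1..L}. l < xbar (\<lambda>(i, m). \<omega> m) 0 r \<and> (\<forall>n\<ge>1. xbar (\<lambda>(i, m). \<omega> m) 0 r \<le> xbar (\<lambda>(i, m). \<omega> m) 0 n)}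
      - real (k - 1) * (1 + 45 / x ^ 6 * (\<Sum>n. inverse (real n ^ 2))) / a\<^sup>2
    \<le> PCS k B mu sg"
proof -
  let ?M = "obs_measure k mu sg" and ?V = "1 + 45 / x ^ 6 * (\<Sum>n. inverse (real n ^ 2))"
  let ?good = "{\<omega> \<in> space ?M. \<exists>r\<in>{1..L}. l < xbar \<omega> 1 r \<and> (\<forall>n\<ge>1. xbar \<omega> 1 r \<le> xbar \<omega> 1 n)}"
  let ?bad = "{\<omega> \<in> space ?M. real (card {2..k}) * Cfun x + a \<le> (\<Sum>i\<in>{2..k}. survival l B i \<omega>)}"
  let ?sel = "{\<omega> \<in> space ?M. greedy_select k B \<omega> = 1}"
  have x0: "0 < x" unfolding x using l sb by simp
  \<comment> \<open>\<open>x\<close> bounds the standardised distances of all inferior means to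
    \<open>l\<close> from below; as \<open>Cfun\<close> decreases, \<open>Cfun x\<close> bounds
    every mean survival time.\<close>
  have xle: "mu i < l" "x \<le> (l - mu i) / sg i" if i: "i \<in> {2..k}" for i
  proof -
    show "mu i < l" using gap[OF i] l by simp
    have "x \<le> (l - mu i) / sb" unfolding x using gap[OF i] sb by (intro divide_right_mono) auto
    also have "\<dots> \<le> (l - mu i) / sg i"
      using sb(1)[OF i] sg_pos[of i] i \<open>mu i < l\<close> by (intro divide_left_mono) auto
    finally show "x \<le> (l - mu i) / sg i" .
  qed
  have mean: "expectation (survival l B i) \<le> Cfun x"
    and second: "expectation (\<lambda>\<omega>. (survival l B i \<omega>)\<^sup>2) \<le> ?V" if i: "i \<in> {2..k}" for i
  proof -
    have i': "i \<in> {1..k}" using i by auto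
    interpret N: normal_walk ?M "\<lambda>n \<omega>. \<omega> (i, n)" "mu i" "sg i" by (rule normal_walk_stream[OF i'])
    have "expectation (survival l B i) \<le> Cfun ((l - mu i) / sg i)"
      using N.expectation_survival_time_le[OF xle(1)[OF i], where K = B] unfolding avg_eq_xbar[OF i'] survival_def[abs_def] .
    also have "\<dots> \<le> Cfun x"
      using Cfun_strict_antimono[OF x0, of "(l - mu i) / sg i"] xle(2)[OF i] by (cases "x = (l - mu i) / sg i") auto
    finally show "expectation (survival l B i) \<le> Cfun x" .
    have "expectation (\<lambda>\<omega>. (survival l B i \<omega>)\<^sup>2) \<le> 1 + 45 / ((l - mu i) / sg i) ^ 6 * (\<Sum>n. inverse (real n ^ 2))"
      using N.expectation_survival_time_square_le[OF xle(1)[OF i], where K = B] unfolding avg_eq_xbar[OF i'] survival_def .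
    also have "\<dots> \<le> ?V"
      using x0 xle(2)[OF i] inverse_power_summable[of 2, where 'a = real]
      by (intro add_left_mono mult_right_mono divide_left_mono power_mono mult_pos_pos suminf_nonneg zero_less_power) auto
    finally show "expectation (\<lambda>\<omega>. (survival l B i \<omega>)\<^sup>2) \<le> ?V" .
  qed
  have bad: "prob ?bad \<le> real (k - 1) * ?V / a\<^sup>2"
  proof -
    have "prob ?bad \<le> real (card {2..k}) * ?V / a\<^sup>2"
      by (rule sum_tail_Chebyshev[where K = "real B"])
         (use indep_survival survival_bound mean second a(2) in \<open>simp_all del: card_atLeastAtMost\<close>)
    then show ?thesis by simp
  qed
  have "1 \<in> {1..k}" using k by simp
  interpret N: normal_walk ?M "\<lambda>n \<omega>. \<omega> (1, n)" "mu 1" "sg 1"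
    by (rule normal_walk_stream) fact
  let ?Q = "\<lambda>\<omega>. \<exists>r\<in>{1..L}. l < xbar (\<lambda>(i, m). \<omega> m) 0 r \<and> (\<forall>n\<ge>1. xbar (\<lambda>(i, m). \<omega> m) 0 r \<le> xbar (\<lambda>(i, m). \<omega> m) 0 n)"
  have xb [measurable]: "(\<lambda>\<omega>. xbar (\<lambda>(i, m). \<omega> m) 0 n) \<in> borel_measurable (single_stream (mu 1) (sg 1))" for n
  proof -
    have "0 < sg 1" using sg_pos \<open>1 \<in> {1..k}\<close> by blast
    then interpret SS: normal_walk "single_stream (mu 1) (sg 1)" "\<lambda>n \<omega>. \<omega> n" "mu 1" "sg 1"
      by (rule normal_walk_single_stream)
    show ?thesis using SS.avg_measurable[of n] by (simp add: SS.avg_def[abs_def] xbar_def)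
  qed
  have [measurable]: "Measurable.pred (single_stream (mu 1) (sg 1))
      (\<lambda>\<omega>. xbar (\<lambda>(i, m). \<omega> m) 0 r \<le> xbar (\<lambda>(i, m). \<omega> m) 0 n)" for r n
    unfolding pred_def by (rule borel_measurable_le) (rule xb)+
  have "measure (single_stream (mu 1) (sg 1)) {\<omega> \<in> space (single_stream (mu 1) (sg 1)). ?Q \<omega>} =
      prob {\<omega> \<in> space ?M. ?Q (\<lambda>n. \<omega> (1, n))}"
    by (rule N.prob_eq_single_stream) measurable
  also have "{\<omega> \<in> space ?M. ?Q (\<lambda>n. \<omega> (1, n))} = ?good" by (simp add: xbar_def)
  also have "prob ?good \<le> prob (?sel \<union> ?bad)"
  proof (rule finite_measure_mono)
    show "?good \<subseteq> ?sel \<union> ?bad"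
    proof
      fix \<omega> assume g: "\<omega> \<in> ?good"
      then obtain r where r: "r \<in> {1..L}" "l < xbar \<omega> 1 r" "\<And>n. 1 \<le> n \<Longrightarrow> xbar \<omega> 1 r \<le> xbar \<omega> 1 n"
        by blast
      show "\<omega> \<in> ?sel \<union> ?bad"
      proof (cases "\<omega> \<in> ?bad")
        case False
        then have "(\<Sum>i\<in>{2..k}. survival l B i \<omega>) < real B - real L"
          using g unfolding a(1) by auto
        then have "real (L + (\<Sum>i\<in>{2..k}. card {n. n < B \<and> (\<forall>j\<in>{1..n}. l < xbar \<omega> i j)})) < real B"
          by (simp add: survival_def)
        then have "greedy_select k B \<omega> = 1"
          using greedy_select_eq_1[OF k, of r L \<omega> l] r unfolding of_nat_less_iff by auto
        then show ?thesis using g by simp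
      qed simp
    qed
    have "?sel \<in> events"
      using measurable_greedy_select[OF sets_obs, of k B] by measurable
    moreover have "?bad \<in> events"
    proof -
      have [measurable]: "survival l B i \<in> borel_measurable ?M" for i
        using indep_survival[of l B UNIV] by (auto simp: indep_vars_def)
      show ?thesis by measurable
    qed
    ultimately show "?sel \<union> ?bad \<in> events" by (rule sets.Un)
  qed
  also have "\<dots> \<le> prob ?sel + prob ?bad"
  proof (rule measure_Un_le)
    show "?sel \<in> events"
      using measurable_greedy_select[OF sets_obs, of k B] by measurable
    have [measurable]: "survival l B i \<in> borel_measurable ?M" for i
      using indep_survival[of l B UNIV] by (auto simp: indep_vars_def)
    show "?bad \<in> events" by measurable
  qed
  finally show ?thesis using bad unfolding PCS_def by linarith
qed

end

section \<open>The limit\<close>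

lemma continuous_inverse_Cfun:
  assumes "0 < g" "0 < s"
  shows "((\<lambda>g. 1 / Cfun (g / s)) \<longlongrightarrow> 1 / Cfun (g / s)) (at_left g)"
proof -
  have "isCont Cfun (g / s)"
    using continuous_on_Cfun assms by (simp add: continuous_on_eq_continuous_at)
  then have "isCont (\<lambda>g. 1 / Cfun (g / s)) g"
    using Cfun_ge_1[of "g / s"] assms by (intro continuous_intros isCont_o2[of g "\<lambda>g. g / s" Cfun]) auto
  then show ?thesis unfolding isCont_def by (rule filterlim_mono) (auto simp: at_le)
qed

text \<open>The strict inequality \<open>Cfun ((gamma - g) / sigmabar) < c\<close> leaves a budget surplus linear in \<open>k\<close>
  for the law of large numbers. At \<open>g = gamma0\<close> there is none, so the theorem lets \<open>g\<close> increase
  to \<open>gamma0\<close> and uses the continuity of \<open>Cfun\<close>.\<close>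
lemma liminf_PCS_ge:
  fixes mu sg :: "nat \<Rightarrow> nat \<Rightarrow> real"
  assumes mu1: "\<And>k. k \<ge> 2 \<Longrightarrow> mu k 1 = mu1"
    and sg1: "\<And>k. k \<ge> 2 \<Longrightarrow> sg k 1 = sigma1"
    and sigma1_pos: "sigma1 > 0"
    and sg_pos: "\<And>k i. k \<ge> 2 \<Longrightarrow> i \<in> {1..k} \<Longrightarrow> sg k i > 0"
    and sigmabar_pos: "sigmabar > 0"
    and gap: "\<And>k i. k \<ge> 2 \<Longrightarrow> i \<in> {2..k} \<Longrightarrow> mu k 1 - mu k i \<ge> gamma"
    and var_bound: "\<And>k i. k \<ge> 2 \<Longrightarrow> i \<in> {1..k} \<Longrightarrow> (sg k i)\<^sup>2 \<le> sigmabar\<^sup>2"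
    and g: "0 < g" "g < gamma" and c: "Cfun ((gamma - g) / sigmabar) < c"
  shows "ereal (1 / Cfun (g / sigma1)) \<le> liminf (\<lambda>k. ereal (PCS k (nat \<lfloor>c * real k\<rfloor>) (mu k) (sg k)))"
proof -
  interpret N: normal_walk "single_stream mu1 sigma1" "\<lambda>n \<omega>. \<omega> n" mu1 sigma1
    by (rule normal_walk_single_stream[OF sigma1_pos])
  have avg: "N.avg n \<omega> = xbar (\<lambda>(i, m). \<omega> m) 0 n" for n \<omega> by (simp add: N.avg_def xbar_def)
  define x where "x = (gamma - g) / sigmabar"
  define V where "V = 1 + 45 / x ^ 6 * (\<Sum>n. inverse (real n ^ 2))"
  define d where "d = c - Cfun x"
  define r where "r L = measure (single_stream mu1 sigma1) {\<omega> \<in> space (single_stream mu1 sigma1).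
      \<exists>r\<in>{1..L}. mu1 - g < N.avg r \<omega> \<and> (\<forall>n\<ge>1. N.avg r \<omega> \<le> N.avg n \<omega>)}" for L
  have x: "0 < x" unfolding x_def using g sigmabar_pos by simp
  have d: "0 < d" unfolding d_def x_def using c by simp
  \<comment> \<open>This makes the rounded budget at least \<open>k\<close>, enough for the initial
    observations.\<close>
  have c1: "1 < c" using Cfun_ge_1[OF x] c unfolding x_def by simp
  have "0 \<le> (\<Sum>n. inverse (real n ^ 2))"
    using inverse_power_summable[of 2, where 'a = real] by (intro suminf_nonneg) auto
  then have V: "0 \<le> V" unfolding V_def using x by simp
  \<comment> \<open>The surplus \<open>d * real k\<close> is halved: one half covers
    \<open>L\<close> and a loss of at most 1 by the floor, whence the threshold on \<open>k\<close>;
    the other bounds \<open>a\<close> from below, and squaring this half produces the factor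
    4.\<close>
  have bound: "r L - 4 * V / d\<^sup>2 * (1 / real k) \<le> PCS k (nat \<lfloor>c * real k\<rfloor>) (mu k) (sg k)"
    if k: "2 \<le> k" "2 * (real L + 1) / d \<le> real k" for k L
  proof -
    interpret O: observations k "mu k" "sg k" by unfold_locales (rule sg_pos[OF k(1)])
    let ?B = "nat \<lfloor>c * real k\<rfloor>"
    define a where "a = real ?B - real L - real (k - 1) * Cfun x"
    have ck: "real k \<le> c * real k" using c1 by (simp add: mult_le_cancel_right1)
    then have kB: "k \<le> ?B" by (simp add: le_nat_floor)
    have "c * real k - 1 \<le> real ?B" using ck by linarith
    moreover have "real (k - 1) * Cfun x \<le> real k * Cfun x"
      using Cfun_ge_1[OF x] by (intro mult_right_mono) auto
    moreover have "real L + 1 \<le> d * real k / 2" using k(2) d by (simp add: field_simps)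
    moreover have "d * real k = c * real k - real k * Cfun x" by (simp add: d_def algebra_simps)
    ultimately have a_ge: "d * real k / 2 \<le> a" unfolding a_def by argo
    have dk: "0 < d * real k / 2" using d k by simp
    have a_pos: "0 < a" using a_ge dk by linarith
    have "r L - real (k - 1) * V / a\<^sup>2 \<le> PCS k ?B (mu k) (sg k)"
    proof -
      have sb: "sg k i \<le> sigmabar" if "i \<in> {2..k}" for i
      proof (rule power2_le_imp_le)
        show "(sg k i)\<^sup>2 \<le> sigmabar\<^sup>2" by (rule var_bound[OF k(1)]) (use that in simp)
        show "0 \<le> sigmabar" using sigmabar_pos by simp
      qed
      show ?thesis
        unfolding r_def V_def avg mu1[OF k(1), symmetric] sg1[OF k(1), symmetric]
      proof (rule O.PCS_lower_bound[where g = gamma and sb = sigmabar])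
        show "x = (mu k 1 - g - (mu k 1 - gamma)) / sigmabar" by (simp add: x_def)
        show "gamma \<le> mu k 1 - mu k i" if "i \<in> {2..k}" for i by (rule gap[OF k(1) that])
      qed (use k kB sb sigmabar_pos g a_def a_pos in auto)
    qed
    moreover have "real (k - 1) * V / a\<^sup>2 \<le> 4 * V / d\<^sup>2 * (1 / real k)"
    proof -
      have "real (k - 1) * V / a\<^sup>2 \<le> real k * V / (d * real k / 2)\<^sup>2"
        using a_ge dk V k(1) by (intro frac_le mult_right_mono power_mono) auto
      also have "\<dots> = 4 * V / d\<^sup>2 * (1 / real k)"
        using k d by (simp add: power2_eq_square field_simps)
      finally show ?thesis .
    qed
    ultimately show ?thesis by linarith
  qed
  have r_le: "ereal (r L) \<le> liminf (\<lambda>k. ereal (PCS k (nat \<lfloor>c * real k\<rfloor>) (mu k) (sg k)))" for L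
  proof -
    have "(\<lambda>k. r L - 4 * V / d\<^sup>2 * (1 / real k)) \<longlonglongrightarrow> r L - 4 * V / d\<^sup>2 * 0"
      by (intro tendsto_intros lim_1_over_n)
    then have "ereal (r L) = liminf (\<lambda>k. ereal (r L - 4 * V / d\<^sup>2 * (1 / real k)))"
      by (intro lim_imp_Liminf[symmetric]) auto
    also have "\<dots> \<le> liminf (\<lambda>k. ereal (PCS k (nat \<lfloor>c * real k\<rfloor>) (mu k) (sg k)))"
    proof (rule Liminf_mono)
      have "\<forall>\<^sub>F k in sequentially. max 2 (2 * (real L + 1) / d) \<le> real k"
        using filterlim_real_sequentially unfolding filterlim_at_top by blast
      then show "\<forall>\<^sub>F k in sequentially. ereal (r L - 4 * V / d\<^sup>2 * (1 / real k)) \<le> ereal (PCS k (nat \<lfloor>c * real k\<rfloor>) (mu k) (sg k))"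
        by eventually_elim (use bound in auto)
    qed
    finally show ?thesis .
  qed
  have "r \<longlonglongrightarrow> 1 / Cfun (g / sigma1)"
    using N.prob_early_min_tendsto[of "mu1 - g"] g unfolding r_def[abs_def] by simp
  then have "(\<lambda>L. ereal (r L)) \<longlonglongrightarrow> ereal (1 / Cfun (g / sigma1))" by simp
  then show ?thesis by (rule LIMSEQ_le_const2) (use r_le in auto)
qed

theorem theorem1:
  fixes mu sg :: "nat \<Rightarrow> nat \<Rightarrow> real"
    and mu1 sigma1 gamma sigmabar c :: real
  assumes mu1: "\<And>k. k \<ge> 2 \<Longrightarrow> mu k 1 = mu1"
    and sg1: "\<And>k. k \<ge> 2 \<Longrightarrow> sg k 1 = sigma1"
    and sigma1_pos: "sigma1 > 0"
    and sg_pos: "\<And>k i. k \<ge> 2 \<Longrightarrow> i \<in> {1..k} \<Longrightarrow> sg k i > 0"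
    and gamma_pos: "gamma > 0"
    and sigmabar_pos: "sigmabar > 0"
    and gap: "\<And>k i. k \<ge> 2 \<Longrightarrow> i \<in> {2..k} \<Longrightarrow> mu k 1 - mu k i \<ge> gamma"
    and var_bound: "\<And>k i. k \<ge> 2 \<Longrightarrow> i \<in> {1..k} \<Longrightarrow> (sg k i)\<^sup>2 \<le> sigmabar\<^sup>2"
    and c_big: "c > Cfun (gamma / sigmabar)"
  shows "(\<exists>!gamma0. gamma0 \<in> {0<..<gamma} \<and> Cfun ((gamma - gamma0) / sigmabar) = c) \<and>
    (\<forall>gamma0 \<in> {0<..<gamma}. Cfun ((gamma - gamma0) / sigmabar) = c \<longrightarrow>
           liminf (\<lambda>k. ereal (PCS k (nat \<lfloor>c * real k\<rfloor>) (mu k) (sg k)))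
             \<ge> ereal (measure (single_stream mu1 sigma1)
                  {\<omega> \<in> space (single_stream mu1 sigma1).
                     \<forall>n\<ge>1. xbar (\<lambda>(i, m). \<omega> m) 0 n > mu1 - gamma0})
           \<and> measure (single_stream mu1 sigma1)
                  {\<omega> \<in> space (single_stream mu1 sigma1).
                     \<forall>n\<ge>1. xbar (\<lambda>(i, m). \<omega> m) 0 n > mu1 - gamma0}
               = 1 / Cfun (gamma0 / sigma1)
           \<and> 1 / Cfun (gamma0 / sigma1) > 0)"
proof (intro conjI ballI impI)
  \<comment> \<open>\<open>x\<close> stands for \<open>(gamma - gamma0) / sigmabar\<close>, an
    affine bijection that turns the equation for \<open>gamma0\<close> into
    \<open>Cfun x = c\<close>.\<close>
  let ?P = "\<lambda>x. x \<in> {0<..<gamma / sigmabar} \<and> Cfun x = c"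
  have "\<exists>!x. ?P x"
    using gamma_pos sigmabar_pos c_big by (intro Cfun_level_unique) auto
  then obtain x where x: "?P x" and uniq: "\<And>x'. ?P x' \<Longrightarrow> x' = x" by auto
  show "\<exists>!gamma0. gamma0 \<in> {0<..<gamma} \<and> Cfun ((gamma - gamma0) / sigmabar) = c"
  proof (rule ex1I[of _ "gamma - sigmabar * x"])
    show "gamma - sigmabar * x \<in> {0<..<gamma} \<and> Cfun ((gamma - (gamma - sigmabar * x)) / sigmabar) = c"
      using x sigmabar_pos by (auto simp: field_simps)
    fix g assume "g \<in> {0<..<gamma} \<and> Cfun ((gamma - g) / sigmabar) = c"
    then have "?P ((gamma - g) / sigmabar)" using sigmabar_pos by (auto simp: field_simps)
    then have "(gamma - g) / sigmabar = x" by (rule uniq)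
    then show "g = gamma - sigmabar * x" using sigmabar_pos by (auto simp: field_simps)
  qed
next
  fix gamma0 assume g0: "gamma0 \<in> {0<..<gamma}" and level: "Cfun ((gamma - gamma0) / sigmabar) = c"
  interpret N: normal_walk "single_stream mu1 sigma1" "\<lambda>n \<omega>. \<omega> n" mu1 sigma1
    by (rule normal_walk_single_stream[OF sigma1_pos])
  have avg: "N.avg n \<omega> = xbar (\<lambda>(i, m). \<omega> m) 0 n" for n \<omega> by (simp add: N.avg_def xbar_def)
  show eq: "measure (single_stream mu1 sigma1) {\<omega> \<in> space (single_stream mu1 sigma1).
      \<forall>n\<ge>1. xbar (\<lambda>(i, m). \<omega> m) 0 n > mu1 - gamma0} = 1 / Cfun (gamma0 / sigma1)"
    using N.prob_avg_always_greater[of "mu1 - gamma0"] g0 unfolding avg by simp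
  show "1 / Cfun (gamma0 / sigma1) > 0"
    using Cfun_ge_1[of "gamma0 / sigma1"] g0 sigma1_pos by simp
  let ?lim = "liminf (\<lambda>k. ereal (PCS k (nat \<lfloor>c * real k\<rfloor>) (mu k) (sg k)))"
  \<comment> \<open>For \<open>g < gamma0\<close> the argument \<open>(gamma - g) / sigmabar\<close>
    is larger than at \<open>gamma0\<close>, so strict monotonicity of \<open>Cfun\<close> puts its
    value strictly below \<open>c\<close>.\<close>
  have le: "ereal (1 / Cfun (g / sigma1)) \<le> ?lim" if g: "0 < g" "g < gamma0" for g
  proof (rule liminf_PCS_ge[where mu = mu and sg = sg, OF mu1 sg1 sigma1_pos sg_pos sigmabar_pos gap var_bound g(1)])
    have "0 < (gamma - gamma0) / sigmabar" "(gamma - gamma0) / sigmabar < (gamma - g) / sigmabar"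
      using g g0 sigmabar_pos by (auto intro: divide_strict_right_mono)
    then show "Cfun ((gamma - g) / sigmabar) < c" using Cfun_strict_antimono level by metis
  qed (use g g0 in auto)
  have "((\<lambda>g. ereal (1 / Cfun (g / sigma1))) \<longlongrightarrow> ereal (1 / Cfun (gamma0 / sigma1))) (at_left gamma0)"
    using continuous_inverse_Cfun[of gamma0 sigma1] g0 sigma1_pos by simp
  moreover have "\<forall>\<^sub>F g in at_left gamma0. ereal (1 / Cfun (g / sigma1)) \<le> ?lim"
    using eventually_at_left_real[of 0 gamma0] g0 by (auto elim!: eventually_mono intro: le)
  ultimately have "ereal (1 / Cfun (gamma0 / sigma1)) \<le> ?lim"
    by (rule tendsto_upperbound) simp
  then show "ereal (measure (single_stream mu1 sigma1) {\<omega> \<in> space (single_stream mu1 sigma1).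
      \<forall>n\<ge>1. xbar (\<lambda>(i, m). \<omega> m) 0 n > mu1 - gamma0}) \<le> ?lim"
    unfolding eq .
qed

end
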